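(* There exists an absolute constant $c_1>0$ such that the following holds. Let $C$ be an isotropic convex body in $\mathbb{R}^n$ and let $K$ be a centrally symmetric convex body in $\mathbb{R}^n$. Then, for any $s\ge 1$ and $\mathbf{t}=(t_1,\ldots,t_s)\in\mathbb{R}^s$, $$c_1L_C\,R(K^{\circ})\,\|\mathbf{t}\|_2\ \le\ \|\mathbf{t}\|_{C^s,K}\ \le\ \sqrt{n}\,L_C\,R(K^{\circ})\,\|\mathbf{t}\|_2 .$$
   Context: A convex body in $\mathbb{R}^n$ is a compact convex set with non-empty interior; it is centrally symmetric if $-K=K$. $\|x\|_K=\inf\{r>0:x\in rK\}$. A convex body $C$ is isotropic if it has volume $1$, its barycenter is at the origin, and there is a constant $L_C>0$ (the isotropic constant) with $\int_C\langle x,\xi\rangle^2dx=L_C^2$ for all $\xi\in S^{n-1}$. $K^{\circ}=\{y:\langle x,y\rangle\le 1\ \forall x\in K\}$ is the polar body, and $R(K^{\circ})$ is its radius: the smallest $R>0$ such that $K^{\circ}\subseteq RB_2^n$, where $B_2^n$ is the Euclidean unit ball. For $\mathrm{vol}_n(C)=1$, $$\|\mathbf{t}\|_{C^s,K}=\int_C\cdots\int_C\Big\|\sum_{j=1}^st_jx_j\Big\|_K\,dx_1\cdots dx_s .$$ "Absolute constant" means independent of $n,s,C,K,\mathbf{t}$. *)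

theory Defs
  imports "HOL-Analysis.Analysis"
begin

text \<open>
  The constant in the theorem must not depend on the dimension, so the dimension cannot be a type
  here. A vector of \<open>\<real>\<^sup>n\<close> is an extensional function on \<open>{..<n}\<close>, i.e. an element of
  \<open>{..<n} \<rightarrow>\<^sub>E UNIV\<close>. This is both the underlying set of the finite product topology and the space
  of the finite product of Lebesgue(-Borel) measures.
\<close>

definition Rn :: "nat \<Rightarrow> (nat \<Rightarrow> real) topology"
  where "Rn n = product_topology (\<lambda>_. euclideanreal) {..<n}"

definition vol :: "nat \<Rightarrow> (nat \<Rightarrow> real) measure"
  where "vol n = PiM {..<n} (\<lambda>_. lborel)"

definition zero_vec :: "nat \<Rightarrow> nat \<Rightarrow> real"
  where "zero_vec n = (\<lambda>i\<in>{..<n}. 0)"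

definition add_vec :: "nat \<Rightarrow> (nat \<Rightarrow> real) \<Rightarrow> (nat \<Rightarrow> real) \<Rightarrow> nat \<Rightarrow> real"
  where "add_vec n x y = (\<lambda>i\<in>{..<n}. x i + y i)"

definition scale_vec :: "nat \<Rightarrow> real \<Rightarrow> (nat \<Rightarrow> real) \<Rightarrow> nat \<Rightarrow> real"
  where "scale_vec n r x = (\<lambda>i\<in>{..<n}. r * x i)"

definition inner_vec :: "nat \<Rightarrow> (nat \<Rightarrow> real) \<Rightarrow> (nat \<Rightarrow> real) \<Rightarrow> real"
  where "inner_vec n x y = (\<Sum>i<n. x i * y i)"

definition lincomb :: "nat \<Rightarrow> nat \<Rightarrow> (nat \<Rightarrow> real) \<Rightarrow> (nat \<Rightarrow> nat \<Rightarrow> real) \<Rightarrow> nat \<Rightarrow> real"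
  where "lincomb n s t x = (\<lambda>i\<in>{..<n}. \<Sum>j<s. t j * x j i)"

definition unit_ball :: "nat \<Rightarrow> (nat \<Rightarrow> real) set"
  where "unit_ball n = {x \<in> topspace (Rn n). L2_set x {..<n} \<le> 1}"

definition unit_sphere :: "nat \<Rightarrow> (nat \<Rightarrow> real) set"
  where "unit_sphere n = {x \<in> topspace (Rn n). L2_set x {..<n} = 1}"

definition convex_set :: "nat \<Rightarrow> (nat \<Rightarrow> real) set \<Rightarrow> bool"
  where "convex_set n K \<longleftrightarrow>
    (\<forall>x\<in>K. \<forall>y\<in>K. \<forall>u\<ge>0. \<forall>v\<ge>0. u + v = 1 \<longrightarrow>
      add_vec n (scale_vec n u x) (scale_vec n v y) \<in> K)"

definition convex_body :: "nat \<Rightarrow> (nat \<Rightarrow> real) set \<Rightarrow> bool"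
  where "convex_body n K \<longleftrightarrow>
    compactin (Rn n) K \<and> convex_set n K \<and> (Rn n) interior_of K \<noteq> {}"

definition centrally_symmetric :: "nat \<Rightarrow> (nat \<Rightarrow> real) set \<Rightarrow> bool"
  where "centrally_symmetric n K \<longleftrightarrow> scale_vec n (-1) ` K = K"

definition gauge_norm :: "nat \<Rightarrow> (nat \<Rightarrow> real) set \<Rightarrow> (nat \<Rightarrow> real) \<Rightarrow> real"
  where "gauge_norm n K x = Inf {r. r > 0 \<and> x \<in> scale_vec n r ` K}"

definition polar :: "nat \<Rightarrow> (nat \<Rightarrow> real) set \<Rightarrow> (nat \<Rightarrow> real) set"
  where "polar n K = {y \<in> topspace (Rn n). \<forall>x\<in>K. inner_vec n x y \<le> 1}"

definition radius :: "nat \<Rightarrow> (nat \<Rightarrow> real) set \<Rightarrow> real"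
  where "radius n A = (LEAST R. R > 0 \<and> A \<subseteq> scale_vec n R ` unit_ball n)"

definition barycenter :: "nat \<Rightarrow> (nat \<Rightarrow> real) set \<Rightarrow> nat \<Rightarrow> real"
  where "barycenter n C = (\<lambda>i\<in>{..<n}. (LINT x:C|vol n. x i) / measure (vol n) C)"

definition has_isotropic_constant :: "nat \<Rightarrow> (nat \<Rightarrow> real) set \<Rightarrow> real \<Rightarrow> bool"
  where "has_isotropic_constant n C L \<longleftrightarrow>
    L > 0 \<and> (\<forall>\<xi>\<in>unit_sphere n. (LINT x:C|vol n. (inner_vec n x \<xi>)\<^sup>2) = L\<^sup>2)"

definition isotropic :: "nat \<Rightarrow> (nat \<Rightarrow> real) set \<Rightarrow> bool"
  where "isotropic n C \<longleftrightarrow>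
    convex_body n C \<and> measure (vol n) C = 1 \<and> barycenter n C = zero_vec n \<and>
    (\<exists>L. has_isotropic_constant n C L)"

text \<open>For \<open>n \<ge> 1\<close> the sphere is nonempty, so the constant of an isotropic body is unique.\<close>

definition isotropic_constant :: "nat \<Rightarrow> (nat \<Rightarrow> real) set \<Rightarrow> real"
  where "isotropic_constant n C = (THE L. has_isotropic_constant n C L)"

text \<open>
  The \<open>s\<close>-fold integral over \<open>C \<times> \<dots> \<times> C\<close>, with the product of \<open>s\<close> copies of
  \<open>n\<close>-dimensional volume. Only the entries of \<open>t\<close> with index below \<open>s\<close> matter.
\<close>

definition multi_norm ::
    "nat \<Rightarrow> nat \<Rightarrow> (nat \<Rightarrow> real) set \<Rightarrow> (nat \<Rightarrow> real) set \<Rightarrow> (nat \<Rightarrow> real) \<Rightarrow> real"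
  where "multi_norm n s C K t =
    (LINT x:PiE {..<s} (\<lambda>_. C)|PiM {..<s} (\<lambda>_. vol n). gauge_norm n K (lincomb n s t x))"

end

theory Submission
  imports Defs "HOL-Probability.Probability" "HOL-Real_Asymp.Real_Asymp"
begin

text \<open>
  By duality the gauge of \<open>K\<close> is squeezed between linear functionals and the Euclidean norm:
  \<open>\<bar>\<langle>x, y\<rangle>\<bar> \<le> \<parallel>x\<parallel>\<^sub>K \<le> R \<bar>x\<bar>\<close> for every \<open>y\<close> in the polar body, where \<open>R\<close> is the radius of the
  polar body (\<open>gauge_ge\<close>, \<open>gauge_le\<close>). Put \<open>X = \<Sum>\<^sub>j t\<^sub>j x\<^sub>j\<close> with the \<open>x\<^sub>j\<close> independent and uniform
  on \<open>C\<close>.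

  The upper bound is the second moment method: isotropy and independence give
  \<open>E \<bar>X\<bar>\<^sup>2 = n L\<^sup>2 \<parallel>t\<parallel>\<^sup>2\<close>, hence \<open>E \<bar>X\<bar> \<le> \<surd>n L \<parallel>t\<parallel>\<close>.

  For the lower bound fix \<open>y\<close> in the polar body with direction \<open>\<theta>\<close>. The scalar \<open>S = \<langle>X, \<theta>\<rangle>\<close> is a
  weighted sum of independent centred variables of variance \<open>L\<^sup>2\<close>, so \<open>E S\<^sup>2 = L\<^sup>2 \<parallel>t\<parallel>\<^sup>2\<close>; a bound
  \<open>E S\<^sup>4 \<le> D (E S\<^sup>2)\<^sup>2\<close> prevents \<open>S\<close> from concentrating its second moment on rare large values and
  so yields \<open>E \<bar>S\<bar> \<ge> c (E S\<^sup>2)\<^sup>1\<^sup>/\<^sup>2\<close> (\<open>first_moment_lower_bound\<close>). By independence the bound for \<open>S\<close>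
  follows from the one for a single \<open>\<langle>x, \<theta>\<rangle>\<close> (\<open>wsum_fourth_moment\<close>). Taking the supremum of
  \<open>\<bar>y\<bar>\<close> over the polar body produces the factor \<open>R\<close>.

  What makes the constant independent of the dimension is the fourth moment of a single linear
  functional on \<open>C\<close> (\<open>fourth_moment_bound\<close>). By the Prekopa-Leindler inequality
  (\<open>prekopa_leindler_PiM\<close>) its tail \<open>a \<mapsto> P(\<langle>x, \<theta>\<rangle> \<ge> a)\<close> is log-concave. Chebyshev's inequality
  makes the tail at least \<open>3/4\<close> at \<open>-2L\<close> and at most \<open>1/4\<close> at \<open>2L\<close>, and log-concavity propagates this
  drop: every further step of length \<open>4L\<close> loses another factor \<open>3\<close>. Such a tail has a fourth moment
  of at most an absolute constant times \<open>L\<^sup>4\<close>.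
\<close>

section \<open>The Prekopa-Leindler inequality\<close>

text \<open>
  Cutting \<open>A\<close> strictly below a point of \<open>A\<close> exhausts it: a sequence of points of \<open>A\<close> tends to
  the supremum, so the cut sets increase to \<open>A\<close> minus at most its maximum, which is a null set.
  The strict cut is what later makes two translates disjoint, and the summand \<open>c\<close> spares a
  subtraction of possibly infinite measures.
\<close>

lemma emeasure_plus_le_by_cutoffs:
  fixes A :: "real set"
  assumes A[measurable]: "A \<in> sets borel" and "A \<noteq> {}"
    and le: "\<And>a. a \<in> A \<Longrightarrow> emeasure lborel (A \<inter> {..<a}) + c \<le> d"
  shows "emeasure lborel A + c \<le> d"
proof -
  obtain s m where s: "incseq s" "\<And>k. \<exists>a\<in>A. s k \<le> a" "A \<subseteq> insert m (\<Union>k::nat. {..<s k})"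
  proof (cases "bdd_above A")
    case True
    let ?s = "\<lambda>k::nat. Sup A - 1 / real (Suc k)"
    show ?thesis
    proof (rule that[of ?s "Sup A"])
      show "incseq ?s"
        by (intro incseq_SucI) (simp add: field_simps)
      show "\<exists>a\<in>A. ?s k \<le> a" for k
      proof -
        have "?s k < Sup A" by simp
        then obtain a where "a \<in> A" "?s k < a" using \<open>A \<noteq> {}\<close> by (rule less_cSupE)
        then show ?thesis by (meson less_imp_le)
      qed
      show "A \<subseteq> insert (Sup A) (\<Union>k. {..<?s k})"
      proof
        fix x assume x: "x \<in> A"
        then have "x \<le> Sup A" using True by (rule cSup_upper)
        moreover have "\<exists>k. x < ?s k" if "x < Sup A"
          using reals_Archimedean[of "Sup A - x"] that by (auto simp: inverse_eq_divide algebra_simps)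
        ultimately show "x \<in> insert (Sup A) (\<Union>k. {..<?s k})"
          by force
      qed
    qed
  next
    case False
    show ?thesis
    proof (rule that[of real 0])
      show "incseq real" by (simp add: incseq_def)
      show "\<exists>a\<in>A. real k \<le> a" for k
        using False by (meson bdd_above.I linorder_le_cases)
      show "A \<subseteq> insert 0 (\<Union>k. {..<real k})"
        using reals_Archimedean2 by auto
    qed
  qed
  have "emeasure lborel A \<le> emeasure lborel ((\<Union>k. A \<inter> {..<s k}) \<union> {m})"
    using s(3) by (intro emeasure_mono) auto
  also have "\<dots> \<le> emeasure lborel (\<Union>k. A \<inter> {..<s k}) + emeasure lborel {m}"
    by (rule emeasure_subadditive) auto
  also have "\<dots> = (SUP k. emeasure lborel (A \<inter> {..<s k}))"
    using s(1) by (subst SUP_emeasure_incseq) (auto simp: incseq_def less_le_trans)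
  finally have "emeasure lborel A + c \<le> (SUP k. emeasure lborel (A \<inter> {..<s k}) + c)"
    by (subst ennreal_SUP_add_left) (auto intro: add_right_mono)
  also have "\<dots> \<le> d"
  proof (rule SUP_least)
    fix k
    obtain a where a: "a \<in> A" "s k \<le> a" using s(2) by blast
    have "emeasure lborel (A \<inter> {..<s k}) + c \<le> emeasure lborel (A \<inter> {..<a}) + c"
      using a by (intro add_right_mono emeasure_mono) auto
    also have "\<dots> \<le> d" by (rule le[OF a(1)])
    finally show "emeasure lborel (A \<inter> {..<s k}) + c \<le> d" .
  qed
  finally show ?thesis .
qed

lemma emeasure_lborel_translate:
  fixes A :: "real set"
  assumes [measurable]: "A \<in> sets borel"
  shows "emeasure lborel {x. x - c \<in> A} = emeasure lborel A"
proof -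
  have "emeasure lborel A = emeasure (distr lborel borel ((+) (- c))) A"
    by (subst lborel_distr_plus) simp
  also have "\<dots> = emeasure lborel {x. x - c \<in> A}"
    by (subst emeasure_distr) (auto intro!: arg_cong[where f="emeasure lborel"])
  finally show ?thesis by simp
qed

lemma emeasure_lborel_reflect:
  fixes A :: "real set"
  assumes [measurable]: "A \<in> sets borel"
  shows "emeasure lborel {x. - x \<in> A} = emeasure lborel A"
proof -
  have "emeasure lborel A = emeasure (distr lborel borel uminus) A"
    by (subst lborel_distr_uminus) simp
  also have "\<dots> = emeasure lborel {x. - x \<in> A}"
    by (subst emeasure_distr) (auto intro!: arg_cong[where f="emeasure lborel"])
  finally show ?thesis by simp
qed

text \<open>
  If \<open>A\<close> ended at its maximum \<open>a\<close> and \<open>B\<close> started at its minimum \<open>b\<close>, then \<open>A + b\<close> would lie below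
  \<open>a + b\<close> and \<open>a + B\<close> above it, so that these two subsets of \<open>A + B\<close> would overlap in a null set.
  Since the extrema need not exist, \<open>A\<close> and \<open>B\<close> are cut at arbitrary points and the cuts are moved
  outwards; the cut of \<open>B\<close> from below is a cut of its reflection from above.
\<close>

lemma brunn_minkowski_real:
  fixes A B D :: "real set"
  assumes [measurable]: "A \<in> sets borel" "B \<in> sets borel" "D \<in> sets borel"
    and ne: "A \<noteq> {}" "B \<noteq> {}" and sum: "\<And>a b. a \<in> A \<Longrightarrow> b \<in> B \<Longrightarrow> a + b \<in> D"
  shows "emeasure lborel A + emeasure lborel B \<le> emeasure lborel D"
proof (rule emeasure_plus_le_by_cutoffs)
  fix a assume a: "a \<in> A"
  let ?B = "{x. - x \<in> B}"
  have "emeasure lborel ?B + emeasure lborel (A \<inter> {..<a}) \<le> emeasure lborel D"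
  proof (rule emeasure_plus_le_by_cutoffs)
    show "?B \<in> sets borel" by measurable
    show "?B \<noteq> {}" using ne by (metis (mono_tags) add.inverse_inverse empty_Collect_eq ex_in_conv)
    fix b' assume "b' \<in> ?B"
    then obtain b where b: "b \<in> B" "b' = - b" by (metis mem_Collect_eq minus_minus)
    let ?L = "{x. x - b \<in> A \<inter> {..<a}}" and ?R = "{x. x - a \<in> B \<inter> {b<..}}"
    have "emeasure lborel (?B \<inter> {..<b'}) = emeasure lborel {x. - x \<in> B \<inter> {b<..}}"
      using b by (auto intro!: arg_cong[where f="emeasure lborel"])
    also have "\<dots> = emeasure lborel (B \<inter> {b<..})"
      by (rule emeasure_lborel_reflect) measurable
    also have "\<dots> = emeasure lborel ?R"
      by (rule emeasure_lborel_translate[symmetric]) measurable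
    finally have R: "emeasure lborel (?B \<inter> {..<b'}) = emeasure lborel ?R" .
    have L: "emeasure lborel (A \<inter> {..<a}) = emeasure lborel ?L"
      by (rule emeasure_lborel_translate[symmetric]) measurable
    have "emeasure lborel ?R + emeasure lborel ?L = emeasure lborel (?R \<union> ?L)"
      by (rule plus_emeasure) auto
    also have "\<dots> \<le> emeasure lborel D"
    proof (intro emeasure_mono subsetI)
      fix x assume "x \<in> ?R \<union> ?L"
      then show "x \<in> D"
        using sum[OF a, of "x - a"] sum[OF _ b(1), of "x - b"] by auto
    qed measurable
    finally show "emeasure lborel (?B \<inter> {..<b'}) + emeasure lborel (A \<inter> {..<a}) \<le> emeasure lborel D"
      by (simp add: R L)
  qed
  then show "emeasure lborel (A \<inter> {..<a}) + emeasure lborel B \<le> emeasure lborel D"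
    by (simp add: emeasure_lborel_reflect add.commute)
qed fact+

lemma emeasure_below_ennreal: "emeasure lborel {u. 0 \<le> u \<and> ennreal u < c} = c"
proof (cases c)
  case (real r)
  then have "{u. 0 \<le> u \<and> ennreal u < c} = {0..<r}"
    by (simp add: set_eq_iff ennreal_less_iff cong: conj_cong)
  then show ?thesis using real(1,2) by simp
next
  case top
  have "of_nat k \<le> emeasure lborel {0::real..}" for k
  proof -
    have "emeasure lborel {0..<real k} \<le> emeasure lborel {0::real..}"
      by (intro emeasure_mono) auto
    then show ?thesis by (simp add: ennreal_of_nat_eq_real_of_nat)
  qed
  then have "(SUP k. of_nat k) \<le> emeasure lborel {0::real..}" by (rule SUP_least)
  then have "emeasure lborel {0::real..} = \<top>"
    by (simp add: ennreal_SUP_of_nat_eq_top top_unique)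
  moreover have "{u. 0 \<le> u \<and> ennreal u < c} = {0..}"
    unfolding top by (simp add: set_eq_iff)
  ultimately show ?thesis unfolding top by simp
qed

lemma nn_integral_layer_cake:
  fixes f :: "real \<Rightarrow> ennreal"
  assumes [measurable]: "f \<in> borel_measurable borel"
  shows "(\<integral>\<^sup>+x. f x \<partial>lborel) =
    (\<integral>\<^sup>+u. emeasure lborel {x. 0 \<le> u \<and> ennreal u < f x} \<partial>lborel)"
proof -
  let ?i = "\<lambda>x u. indicator {u. 0 \<le> u \<and> ennreal u < f x} u :: ennreal"
  have "(\<integral>\<^sup>+x. f x \<partial>lborel) = (\<integral>\<^sup>+x. (\<integral>\<^sup>+u. ?i x u \<partial>lborel) \<partial>lborel)"
    by (subst nn_integral_indicator) (auto simp: emeasure_below_ennreal)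
  also have "\<dots> = (\<integral>\<^sup>+u. (\<integral>\<^sup>+x. ?i x u \<partial>lborel) \<partial>lborel)"
    by (rule lborel_pair.Fubini') measurable
  also have "\<dots> = (\<integral>\<^sup>+u. (\<integral>\<^sup>+x. indicator {x. 0 \<le> u \<and> ennreal u < f x} x \<partial>lborel) \<partial>lborel)"
    by (simp add: indicator_def)
  finally show ?thesis by (subst (asm) nn_integral_indicator) auto
qed

text \<open>
  When both suprema are \<open>1\<close>, the superlevel sets of \<open>f\<close> and \<open>g\<close> at a height \<open>u < 1\<close> are both nonempty,
  and their sum lies in the superlevel set of \<open>h\<close>. Integrating the one-dimensional Brunn-Minkowski
  inequality over \<open>u\<close> gives the claim.
\<close>

lemma prekopa_leindler_real_sup_one:
  fixes f g h :: "real \<Rightarrow> ennreal"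
  assumes [measurable]: "f \<in> borel_measurable borel" "g \<in> borel_measurable borel"
      "h \<in> borel_measurable borel"
    and sup: "(SUP x. f x) = 1" "(SUP x. g x) = 1"
    and fgh: "\<And>x y. f x * g y \<le> (h (x + y))\<^sup>2"
  shows "(\<integral>\<^sup>+x. f x \<partial>lborel) + (\<integral>\<^sup>+x. g x \<partial>lborel) \<le> (\<integral>\<^sup>+x. h x \<partial>lborel)"
proof -
  have le1: "f x \<le> 1" "g x \<le> 1" for x
    using sup by (metis SUP_upper UNIV_I)+
  have level: "emeasure lborel {x. 0 \<le> u \<and> ennreal u < f x}
      + emeasure lborel {x. 0 \<le> u \<and> ennreal u < g x}
      \<le> emeasure lborel {x. 0 \<le> u \<and> ennreal u < h x}" for u
  proof (cases "0 \<le> u \<and> u < 1")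
    case True
    then have u1: "ennreal u < 1" by (simp add: ennreal_less_one_iff)
    show ?thesis
    proof (rule brunn_minkowski_real)
      show "{x. 0 \<le> u \<and> ennreal u < f x} \<noteq> {}" "{x. 0 \<le> u \<and> ennreal u < g x} \<noteq> {}"
        using u1 True sup less_SUP_iff[of "ennreal u" f UNIV] less_SUP_iff[of "ennreal u" g UNIV]
        by auto
      fix a b assume ab: "a \<in> {x. 0 \<le> u \<and> ennreal u < f x}" "b \<in> {x. 0 \<le> u \<and> ennreal u < g x}"
      obtain p where p: "f a = ennreal p" "0 \<le> p"
        using le1(1)[of a] by (cases "f a") (auto simp: top_unique)
      obtain q where q: "g b = ennreal q" "0 \<le> q"
        using le1(2)[of b] by (cases "g b") (auto simp: top_unique)
      have "u < p" "u < q" using ab p q by (auto simp: ennreal_less_iff)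
      then have "u * u < p * q" using True by (intro mult_strict_mono) auto
      then have "(ennreal u)\<^sup>2 < f a * g b"
        using p q True by (simp add: power2_eq_square ennreal_mult[symmetric] ennreal_less_iff)
      also have "\<dots> \<le> (h (a + b))\<^sup>2" by (rule fgh)
      finally have "ennreal u < h (a + b)"
        by (meson linorder_not_le power_mono zero_le)
      then show "a + b \<in> {x. 0 \<le> u \<and> ennreal u < h x}" using True by simp
    qed measurable
  next
    case False
    then have "{x. 0 \<le> u \<and> ennreal u < f x} = {}" "{x. 0 \<le> u \<and> ennreal u < g x} = {}"
      using le1 by (auto simp: not_less)
         (metis ennreal_1 ennreal_leI leD order_trans not_le)+
    then show ?thesis by (simp only: emeasure_empty) simp
  qed
  show ?thesis
    unfolding nn_integral_layer_cake[OF assms(1)] nn_integral_layer_cake[OF assms(2)]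
      nn_integral_layer_cake[OF assms(3)]
    by (subst nn_integral_add[symmetric]) (auto intro!: nn_integral_mono level)
qed

lemma ennreal_four_mult_le: "4 * (a * b) \<le> (a + b)\<^sup>2" for a b :: ennreal
proof (cases "a = \<top> \<or> b = \<top>")
  case True
  then have "a + b = \<top>" by auto
  then have "(a + b)\<^sup>2 = \<top>" by (simp only: power2_eq_square ennreal_top_mult) simp
  then show ?thesis by simp
next
  case False
  then obtain r s where *: "a = ennreal r" "0 \<le> r" "b = ennreal s" "0 \<le> s"
    by (metis ennreal_cases)
  have "4 * (r * s) \<le> (r + s)\<^sup>2"
    using sum_squares_bound[of r s] by (simp add: power2_eq_square algebra_simps)
  then have "ennreal (4 * (r * s)) \<le> ennreal ((r + s)\<^sup>2)" by (rule ennreal_leI)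
  also have "\<dots> = (a + b)\<^sup>2" using * by (simp add: ennreal_power[symmetric])
  finally show ?thesis using * by (simp add: ennreal_mult)
qed

text \<open>
  The functions are normalised to supremum \<open>1\<close>, and the resulting inequality between arithmetic
  means of the integrals is weakened to geometric means. The midpoint in place of the sum rescales \<open>h\<close>
  and accounts for the factor \<open>2\<close> that cancels the \<open>4\<close> of \<open>ennreal_four_mult_le\<close>.
\<close>

lemma prekopa_leindler_real_bounded:
  fixes f g h :: "real \<Rightarrow> ennreal"
  assumes [measurable]: "f \<in> borel_measurable borel" "g \<in> borel_measurable borel"
      "h \<in> borel_measurable borel"
    and fin: "(SUP x. f x) < \<infinity>" "(SUP x. g x) < \<infinity>"
    and fgh: "\<And>x y. f x * g y \<le> (h ((x + y) / 2))\<^sup>2"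
  shows "(\<integral>\<^sup>+x. f x \<partial>lborel) * (\<integral>\<^sup>+x. g x \<partial>lborel) \<le> (\<integral>\<^sup>+x. h x \<partial>lborel)\<^sup>2"
proof (cases "(SUP x. f x) = 0 \<or> (SUP x. g x) = 0")
  case True
  then have "(\<forall>x. f x = 0) \<or> (\<forall>x. g x = 0)"
    by (metis SUP_upper UNIV_I le_zero_eq)
  then show ?thesis by auto
next
  case False
  then obtain M N where M: "(SUP x. f x) = ennreal M" "0 < M" and N: "(SUP x. g x) = ennreal N" "0 < N"
    using fin by (cases "SUP x. f x"; cases "SUP x. g x") (auto simp: less_le)
  define F G H where "F = (\<integral>\<^sup>+x. f x \<partial>lborel)" and "G = (\<integral>\<^sup>+x. g x \<partial>lborel)"
    and "H = (\<integral>\<^sup>+x. h x \<partial>lborel)"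
  let ?m = "ennreal (1 / M)" and ?n = "ennreal (1 / N)" and ?r = "ennreal (sqrt (1 / M * (1 / N)))"
  have r: "?r\<^sup>2 = ?m * ?n"
    using M N by (subst ennreal_power) (auto simp: ennreal_mult[symmetric])
  have "(\<integral>\<^sup>+x. ?m * f x \<partial>lborel) + (\<integral>\<^sup>+x. ?n * g x \<partial>lborel) \<le> (\<integral>\<^sup>+x. ?r * h (x / 2) \<partial>lborel)"
  proof (rule prekopa_leindler_real_sup_one)
    show "(SUP x. ?m * f x) = 1"
      using M by (subst SUP_mult_left_ennreal[symmetric]) (auto simp: ennreal_mult[symmetric])
    show "(SUP x. ?n * g x) = 1"
      using N by (subst SUP_mult_left_ennreal[symmetric]) (auto simp: ennreal_mult[symmetric])
    fix x y
    have "?m * f x * (?n * g y) = ?m * ?n * (f x * g y)" by (simp add: ac_simps)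
    also have "\<dots> \<le> ?m * ?n * (h ((x + y) / 2))\<^sup>2" by (intro mult_left_mono fgh) simp
    finally show "?m * f x * (?n * g y) \<le> (?r * h ((x + y) / 2))\<^sup>2"
      by (simp only: power_mult_distrib r)
  qed measurable
  also have "(\<integral>\<^sup>+x. ?r * h (x / 2) \<partial>lborel) = ?r * (2 * H)"
  proof -
    have "H = (\<integral>\<^sup>+x. h x \<partial>lborel)" by (simp add: H_def)
    also have "\<dots> = ennreal \<bar>1/2\<bar> * (\<integral>\<^sup>+x. h (0 + (1/2) * x) \<partial>lborel)"
      by (rule nn_integral_real_affine) auto
    finally have "2 * H = (ennreal 2 * ennreal (1/2)) * (\<integral>\<^sup>+x. h (x / 2) \<partial>lborel)"
      by (simp add: ac_simps)
    also have "ennreal 2 * ennreal (1/2) = 1" by (subst ennreal_mult[symmetric]) simp_all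
    finally show ?thesis by (simp add: nn_integral_cmult)
  qed
  finally have "?m * F + ?n * G \<le> ?r * (2 * H)"
    by (simp add: F_def G_def nn_integral_cmult)
  then have "(?m * F + ?n * G)\<^sup>2 \<le> (?r * (2 * H))\<^sup>2" by (rule power_mono) simp
  then have "4 * (?m * F * (?n * G)) \<le> ?m * ?n * (4 * H\<^sup>2)"
    using order_trans[OF ennreal_four_mult_le] by (simp only: power_mult_distrib r) simp
  then have "(?m * ?n * 4) * (F * G) \<le> (?m * ?n * 4) * H\<^sup>2" by (simp add: ac_simps)
  moreover have "?m * ?n * 4 = ennreal (1 / M * (1 / N) * 4)"
    unfolding ennreal_numeral[symmetric] using M N
    by (simp add: ennreal_mult[symmetric] del: ennreal_numeral)
  ultimately have "F * G \<le> H\<^sup>2"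
    using M N by (subst (asm) ennreal_mult_le_mult_iff) auto
  then show ?thesis by (simp add: F_def G_def H_def)
qed

lemma SUP_min_of_nat_ennreal: "(SUP k::nat. min a (of_nat k)) = a" for a :: ennreal
proof -
  have "(SUP k::nat. min a (of_nat k)) = min a (SUP k::nat. of_nat k)"
    by (simp add: inf_min[symmetric] inf_SUP)
  then show ?thesis by (simp add: ennreal_SUP_of_nat_eq_top)
qed

lemma nn_integral_SUP_min:
  fixes f :: "real \<Rightarrow> ennreal"
  assumes [measurable]: "f \<in> borel_measurable borel"
  shows "(\<integral>\<^sup>+x. f x \<partial>lborel) = (SUP k::nat. \<integral>\<^sup>+x. min (f x) (of_nat k) \<partial>lborel)"
  by (subst nn_integral_monotone_convergence_SUP[symmetric])
    (auto simp: SUP_min_of_nat_ennreal incseq_def le_fun_def min.coboundedI2 intro!: min.mono)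

text \<open>
  Truncating \<open>f\<close> and \<open>g\<close> preserves the hypothesis, and monotone convergence removes the truncation.
\<close>

lemma prekopa_leindler_real:
  fixes f g h :: "real \<Rightarrow> ennreal"
  assumes [measurable]: "f \<in> borel_measurable borel" "g \<in> borel_measurable borel"
      "h \<in> borel_measurable borel"
    and fgh: "\<And>x y. f x * g y \<le> (h ((x + y) / 2))\<^sup>2"
  shows "(\<integral>\<^sup>+x. f x \<partial>lborel) * (\<integral>\<^sup>+x. g x \<partial>lborel) \<le> (\<integral>\<^sup>+x. h x \<partial>lborel)\<^sup>2"
proof -
  have "(\<integral>\<^sup>+x. min (f x) (of_nat j) \<partial>lborel) * (\<integral>\<^sup>+x. min (g x) (of_nat k) \<partial>lborel)
      \<le> (\<integral>\<^sup>+x. h x \<partial>lborel)\<^sup>2" for j k :: nat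
  proof (rule prekopa_leindler_real_bounded)
    have "(SUP x. min (f x) (of_nat j)) \<le> of_nat j" "(SUP x. min (g x) (of_nat k)) \<le> of_nat k"
      by (auto intro: SUP_least)
    then show "(SUP x. min (f x) (of_nat j)) < \<infinity>" "(SUP x. min (g x) (of_nat k)) < \<infinity>"
      by (auto intro: le_less_trans simp: of_nat_less_top)
    show "min (f x) (of_nat j) * min (g y) (of_nat k) \<le> (h ((x + y) / 2))\<^sup>2" for x y
      by (rule order_trans[OF mult_mono fgh]) auto
  qed measurable
  then show ?thesis
    by (simp add: nn_integral_SUP_min[of f] nn_integral_SUP_min[of g]
        SUP_mult_left_ennreal SUP_mult_right_ennreal SUP_le_iff)
qed

text \<open>
  Integrating out the last coordinate turns the hypothesis in dimension \<open>n + 1\<close>, by the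
  one-dimensional inequality, into the hypothesis for the marginals in dimension \<open>n\<close>. This tensorisation
  is the reason for proving an inequality for functions although only indicators of convex sets are
  needed in the end.
\<close>

theorem prekopa_leindler_PiM:
  fixes f g h :: "(nat \<Rightarrow> real) \<Rightarrow> ennreal"
  assumes "f \<in> borel_measurable (PiM {..<n} (\<lambda>_. lborel))"
    and "g \<in> borel_measurable (PiM {..<n} (\<lambda>_. lborel))"
    and "h \<in> borel_measurable (PiM {..<n} (\<lambda>_. lborel))"
    and "\<And>x y. x \<in> {..<n} \<rightarrow>\<^sub>E UNIV \<Longrightarrow> y \<in> {..<n} \<rightarrow>\<^sub>E UNIV \<Longrightarrow>
      f x * g y \<le> (h (\<lambda>i\<in>{..<n}. (x i + y i) / 2))\<^sup>2"
  shows "(\<integral>\<^sup>+x. f x \<partial>PiM {..<n} (\<lambda>_. lborel)) * (\<integral>\<^sup>+x. g x \<partial>PiM {..<n} (\<lambda>_. lborel))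
    \<le> (\<integral>\<^sup>+x. h x \<partial>PiM {..<n} (\<lambda>_. lborel))\<^sup>2"
  using assms
proof (induction n arbitrary: f g h)
  case 0
  interpret product_sigma_finite "\<lambda>_::nat. lborel :: real measure" by standard
  from "0.prems"(4)[of "\<lambda>_. undefined" "\<lambda>_. undefined"] show ?case
    by (simp add: nn_integral_empty restrict_def)
next
  case (Suc n)
  interpret product_sigma_finite "\<lambda>_::nat. lborel :: real measure" by standard
  let ?P = "\<lambda>n. PiM {..<n} (\<lambda>_::nat. lborel :: real measure)"
  have ins: "{..<Suc n} = insert n {..<n}" by auto
  have [measurable]: "f \<in> borel_measurable (PiM (insert n {..<n}) (\<lambda>_. lborel))"
    "g \<in> borel_measurable (PiM (insert n {..<n}) (\<lambda>_. lborel))"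
    "h \<in> borel_measurable (PiM (insert n {..<n}) (\<lambda>_. lborel))"
    using Suc.prems(1-3) by (simp_all add: ins)
  let ?I = "\<lambda>f x. \<integral>\<^sup>+y. f (x(n := y)) \<partial>lborel"
  have fub: "integral\<^sup>N (?P (Suc n)) u = (\<integral>\<^sup>+x. ?I u x \<partial>?P n)"
    if "u \<in> borel_measurable (PiM (insert n {..<n}) (\<lambda>_. lborel))" for u :: "(nat \<Rightarrow> real) \<Rightarrow> ennreal"
    using that unfolding ins by (intro product_nn_integral_insert) auto
  have "(\<integral>\<^sup>+x. ?I f x \<partial>?P n) * (\<integral>\<^sup>+x. ?I g x \<partial>?P n) \<le> (\<integral>\<^sup>+x. ?I h x \<partial>?P n)\<^sup>2"
  proof (rule Suc.IH)
    show "?I f \<in> borel_measurable (?P n)" "?I g \<in> borel_measurable (?P n)"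
      "?I h \<in> borel_measurable (?P n)"
      by measurable
    fix x y :: "nat \<Rightarrow> real"
    assume xy: "x \<in> {..<n} \<rightarrow>\<^sub>E UNIV" "y \<in> {..<n} \<rightarrow>\<^sub>E UNIV"
    let ?m = "\<lambda>i\<in>{..<n}. (x i + y i) / 2"
    have sp: "x \<in> space (?P n)" "y \<in> space (?P n)" "?m \<in> space (?P n)"
      using xy by (auto simp: space_PiM)
    have meas: "(\<lambda>a. u (z(n := a))) \<in> borel_measurable borel"
      if "z \<in> space (?P n)" "u \<in> borel_measurable (PiM (insert n {..<n}) (\<lambda>_. lborel))"
      for z and u :: "(nat \<Rightarrow> real) \<Rightarrow> ennreal"
    proof -
      have "(\<lambda>a. z(n := a)) \<in> lborel \<rightarrow>\<^sub>M PiM (insert n {..<n}) (\<lambda>_. lborel)"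
        using that(1) by (intro measurable_fun_upd[where J="{..<n}"]) auto
      from measurable_compose[OF this that(2)] show ?thesis by simp
    qed
    show "?I f x * ?I g y \<le> (?I h ?m)\<^sup>2"
    proof (rule prekopa_leindler_real[where f="\<lambda>a. f (x(n := a))" and g="\<lambda>a. g (y(n := a))"
        and h="\<lambda>a. h (?m(n := a))"])
      fix a b
      have "f (x(n := a)) * g (y(n := b)) \<le>
        (h (\<lambda>i\<in>{..<Suc n}. ((x(n := a)) i + (y(n := b)) i) / 2))\<^sup>2"
        
        using xy by (intro Suc.prems(4)) (auto simp: PiE_iff extensional_def)
      also have "(\<lambda>i\<in>{..<Suc n}. ((x(n := a)) i + (y(n := b)) i) / 2) = ?m(n := (a + b) / 2)"
        by (auto simp: fun_eq_iff)
      finally show "f (x(n := a)) * g (y(n := b)) \<le> (h (?m(n := (a + b) / 2)))\<^sup>2" .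
    qed (use meas[OF sp(1), of f] meas[OF sp(2), of g] meas[OF sp(3), of h] in simp_all)
  qed
  then show ?case by (simp add: fub)
qed

section \<open>Moments of weighted sums of independent variables\<close>

text \<open>
  A bounded random variable, so that all moments exist, with mean zero, variance \<open>v\<close> and fourth
  moment \<open>m4\<close>. On the product of \<open>s\<close> copies of the probability space the evaluations
  \<open>\<lambda>x. Y (x j)\<close> are independent copies of it.
\<close>

locale centred_bounded_rv = prob_space M for M :: "'a measure" +
  fixes Y :: "'a \<Rightarrow> real" and b v m4 :: real
  assumes Y_meas[measurable]: "Y \<in> borel_measurable M"
    and Y_bounded: "AE x in M. \<bar>Y x\<bar> \<le> b"
    and Y_mean: "(\<integral>x. Y x \<partial>M) = 0"
    and Y_var: "(\<integral>x. (Y x)\<^sup>2 \<partial>M) = v"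
    and Y_fourth: "(\<integral>x. (Y x) ^ 4 \<partial>M) = m4"
begin

definition wsum :: "nat \<Rightarrow> (nat \<Rightarrow> real) \<Rightarrow> (nat \<Rightarrow> 'a) \<Rightarrow> real"
  where "wsum s t x = (\<Sum>j<s. t j * Y (x j))"

abbreviation power_measure :: "nat \<Rightarrow> (nat \<Rightarrow> 'a) measure"
  where "power_measure s \<equiv> PiM {..<s} (\<lambda>_. M)"

lemma wsum_measurable[measurable]: "wsum s t \<in> borel_measurable (power_measure s)"
  unfolding wsum_def by measurable

lemma Y_power_integrable: "integrable M (\<lambda>x. Y x ^ k)"
proof (rule integrable_const_bound)
  show "AE x in M. norm (Y x ^ k) \<le> b ^ k"
    using Y_bounded by eventually_elim (auto simp: power_abs intro: power_mono)
qed measurable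

lemma wsum_power_integrable: "integrable (power_measure s) (\<lambda>x. wsum s t x ^ k)"
proof -
  interpret P: prob_space "power_measure s"
    by (intro prob_space_PiM prob_space_axioms)
  have "AE x in power_measure s. \<forall>j\<in>{..<s}. \<bar>Y (x j)\<bar> \<le> b"
    by (intro AE_finite_allI finite_lessThan AE_PiM_component prob_space_axioms Y_bounded)
  then have "AE x in power_measure s. norm (wsum s t x ^ k) \<le> (\<Sum>j<s. \<bar>t j\<bar> * b) ^ k"
  proof eventually_elim
    case (elim x)
    have "\<bar>wsum s t x\<bar> \<le> (\<Sum>j<s. \<bar>t j * Y (x j)\<bar>)"
      unfolding wsum_def by (rule sum_abs)
    also have "\<dots> \<le> (\<Sum>j<s. \<bar>t j\<bar> * b)"
      using elim by (intro sum_mono) (auto simp: abs_mult intro!: mult_left_mono)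
    finally show ?case by (auto simp: power_abs intro: power_mono)
  qed
  then show ?thesis by (intro P.integrable_const_bound) measurable
qed

text \<open>
  Conditioning on all but the last variable reduces every moment of the weighted sum to a moment
  of an affine function of a single copy.
\<close>

lemma wsum_power_Suc:
  "(\<integral>x. wsum (Suc s) t x ^ k \<partial>power_measure (Suc s))
    = (\<integral>x. (\<integral>y. (wsum s t x + t s * Y y) ^ k \<partial>M) \<partial>power_measure s)"
proof -
  interpret product_sigma_finite "\<lambda>_::nat. M" by standard
  have ins: "{..<Suc s} = insert s {..<s}" by auto
  have eq: "wsum (Suc s) t (x(s := y)) = wsum s t x + t s * Y y" for x y
    unfolding wsum_def by simp
  have "(\<integral>x. wsum (Suc s) t x ^ k \<partial>power_measure (Suc s))
      = (\<integral>x. (\<integral>y. wsum (Suc s) t (x(s := y)) ^ k \<partial>M) \<partial>power_measure s)"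
    using wsum_power_integrable[of "Suc s" t k] unfolding ins by (intro product_integral_insert) auto
  then show ?thesis by (simp add: eq)
qed

lemma affine_moments:
  "(\<integral>y. (a + c * Y y) \<partial>M) = a"
  "(\<integral>y. (a + c * Y y)\<^sup>2 \<partial>M) = a\<^sup>2 + c\<^sup>2 * v"
  "(\<integral>y. (a + c * Y y) ^ 4 \<partial>M) = a ^ 4 + 6 * c\<^sup>2 * v * a\<^sup>2 + 4 * c ^ 3 * (\<integral>y. Y y ^ 3 \<partial>M) * a + c ^ 4 * m4"
proof -
  note [simp] = Y_power_integrable Y_power_integrable[of 1, simplified] Y_mean Y_var Y_fourth prob_space
  show "(\<integral>y. (a + c * Y y) \<partial>M) = a" by simp
  have "(\<integral>y. (a + c * Y y)\<^sup>2 \<partial>M) = (\<integral>y. a\<^sup>2 + 2 * a * c * Y y + c\<^sup>2 * (Y y)\<^sup>2 \<partial>M)"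
    by (simp add: power2_eq_square algebra_simps)
  then show "(\<integral>y. (a + c * Y y)\<^sup>2 \<partial>M) = a\<^sup>2 + c\<^sup>2 * v" by simp
  have "(\<integral>y. (a + c * Y y) ^ 4 \<partial>M) = (\<integral>y. a ^ 4 + 4 * a ^ 3 * c * Y y + 6 * c\<^sup>2 * a\<^sup>2 * (Y y)\<^sup>2
      + 4 * c ^ 3 * a * Y y ^ 3 + c ^ 4 * Y y ^ 4 \<partial>M)"
    by (rule Bochner_Integration.integral_cong) (auto simp: power2_eq_square eval_nat_numeral algebra_simps)
  then show "(\<integral>y. (a + c * Y y) ^ 4 \<partial>M) = a ^ 4 + 6 * c\<^sup>2 * v * a\<^sup>2
      + 4 * c ^ 3 * (\<integral>y. Y y ^ 3 \<partial>M) * a + c ^ 4 * m4"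
    by (simp add: algebra_simps)
qed

lemma wsum_mean: "(\<integral>x. wsum s t x \<partial>power_measure s) = 0"
proof (induction s)
  case 0
  then show ?case by (simp add: wsum_def)
next
  case (Suc s)
  then show ?case using wsum_power_Suc[of s t 1] by (simp add: affine_moments)
qed

lemma wsum_second_moment: "(\<integral>x. (wsum s t x)\<^sup>2 \<partial>power_measure s) = v * (\<Sum>j<s. (t j)\<^sup>2)"
proof (induction s)
  case 0
  then show ?case by (simp add: wsum_def)
next
  case (Suc s)
  interpret P: prob_space "power_measure s"
    by (intro prob_space_PiM prob_space_axioms)
  show ?case
    by (simp only: wsum_power_Suc affine_moments)
      (simp add: Suc.IH wsum_power_integrable P.prob_space algebra_simps)
qed

text \<open>
  In the expansion of \<open>(S + t Y)\<^sup>4\<close> the odd cross terms contain the mean of \<open>S\<close> or of \<open>Y\<close> and vanish.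
  What is left is \<open>E S\<^sup>4 + 6 t\<^sup>2 v \<cdot> E S\<^sup>2 + t\<^sup>4 m4\<close>, and the mixed term fits into the square
  \<open>(T + t\<^sup>2)\<^sup>2\<close> because \<open>6 v\<^sup>2 \<le> 2 (m4 + 3 v\<^sup>2)\<close>.
\<close>

lemma wsum_fourth_moment:
  "(\<integral>x. wsum s t x ^ 4 \<partial>power_measure s) \<le> (m4 + 3 * v\<^sup>2) * (\<Sum>j<s. (t j)\<^sup>2)\<^sup>2"
proof (induction s)
  case 0
  then show ?case by (simp add: wsum_def)
next
  case (Suc s)
  interpret P: prob_space "power_measure s"
    by (intro prob_space_PiM prob_space_axioms)
  define T where "T = (\<Sum>j<s. (t j)\<^sup>2)"
  have T: "0 \<le> T" unfolding T_def by (intro sum_nonneg) auto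
  have m4: "0 \<le> m4" unfolding Y_fourth[symmetric] by (intro integral_nonneg_AE) auto
  note [simp] = wsum_power_integrable wsum_power_integrable[of _ _ 1, simplified] wsum_mean
    wsum_second_moment P.prob_space
  have "(\<integral>x. wsum (Suc s) t x ^ 4 \<partial>power_measure (Suc s))
      = (\<integral>x. wsum s t x ^ 4 \<partial>power_measure s) + 6 * (t s)\<^sup>2 * v * (v * T) + (t s) ^ 4 * m4"
    by (simp add: wsum_power_Suc affine_moments T_def)
  also have "\<dots> \<le> (m4 + 3 * v\<^sup>2) * T\<^sup>2 + 6 * (t s)\<^sup>2 * v * (v * T) + (t s) ^ 4 * m4"
    using Suc.IH by (simp add: T_def)
  also have "\<dots> \<le> (m4 + 3 * v\<^sup>2) * (T + (t s)\<^sup>2)\<^sup>2"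
  proof -
    have "(m4 + 3 * v\<^sup>2) * (T + (t s)\<^sup>2)\<^sup>2 =
      (m4 + 3 * v\<^sup>2) * T\<^sup>2 + 6 * (t s)\<^sup>2 * v * (v * T) + (t s) ^ 4 * m4 + (2 * m4 * T * (t s)\<^sup>2 + 3 * v\<^sup>2 * (t s) ^ 4)"
      by (simp add: power2_eq_square eval_nat_numeral algebra_simps)
    moreover have "0 \<le> 2 * m4 * T * (t s)\<^sup>2 + 3 * v\<^sup>2 * (t s) ^ 4" using T m4 by simp
    ultimately show ?thesis by linarith
  qed
  finally show ?case by (simp add: T_def)
qed

end

text \<open>
  The elementary inequality \<open>u\<^sup>2 - u\<^sup>4 \<le> u\<close> for \<open>u \<ge> 0\<close>, applied to \<open>u = \<bar>X\<bar> / l\<close>, bounds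
  \<open>\<bar>X\<bar>\<close> below by an expression in the second and fourth moments. It replaces Hoelder's inequality.
\<close>

lemma (in prob_space) first_moment_lower_bound:
  fixes X :: "'a \<Rightarrow> real"
  assumes "integrable M X" "integrable M (\<lambda>x. (X x)\<^sup>2)" "integrable M (\<lambda>x. X x ^ 4)"
    and "0 < \<sigma>" "0 < D" "(\<integral>x. (X x)\<^sup>2 \<partial>M) = \<sigma>\<^sup>2" "(\<integral>x. X x ^ 4 \<partial>M) \<le> D * \<sigma> ^ 4"
  shows "\<sigma> / (2 * sqrt (2 * D)) \<le> (\<integral>x. \<bar>X x\<bar> \<partial>M)"
proof -
  \<comment> \<open>This scale makes the fourth moment term at most half of the second moment term.\<close>
  define l where "l = sqrt (2 * D) * \<sigma>"
  have l: "0 < l" "l\<^sup>2 = 2 * D * \<sigma>\<^sup>2" using assms by (auto simp: l_def power_mult_distrib)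
  have pt: "(X x)\<^sup>2 / l - X x ^ 4 / l ^ 3 \<le> \<bar>X x\<bar>" for x
  proof -
    define u where "u = \<bar>X x\<bar> / l"
    have "u\<^sup>2 \<le> u + u ^ 4"
    proof (cases "u \<le> 1")
      case True
      then have "u * u \<le> u * 1" using l by (intro mult_left_mono) (auto simp: u_def)
      then show ?thesis by (simp add: power2_eq_square add_increasing2)
    next
      case False
      then have "u ^ 2 \<le> u ^ 4" by (intro power_increasing) auto
      then show ?thesis using False by linarith
    qed
    then have "l * u\<^sup>2 - l * u ^ 4 \<le> l * u"
      using l mult_left_mono[of "u\<^sup>2" "u + u ^ 4" l] by (simp add: algebra_simps)
    moreover have "l * u\<^sup>2 = (X x)\<^sup>2 / l" "l * u ^ 4 = X x ^ 4 / l ^ 3" "l * u = \<bar>X x\<bar>"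
      using l(1) by (auto simp: u_def field_simps power2_eq_square eval_nat_numeral)
    ultimately show ?thesis by simp
  qed
  have "\<sigma> / (2 * sqrt (2 * D)) = \<sigma>\<^sup>2 / l - D * \<sigma> ^ 4 / l ^ 3"
  proof -
    have "D * \<sigma> ^ 4 / l ^ 3 = (D * \<sigma>\<^sup>2) * \<sigma>\<^sup>2 / (l\<^sup>2 * l)"
      by (simp add: power2_eq_square eval_nat_numeral)
    also have "\<dots> = \<sigma>\<^sup>2 / (2 * l)"
      unfolding l(2) using assms l(1) by (simp add: field_simps)
    finally have "\<sigma>\<^sup>2 / l - D * \<sigma> ^ 4 / l ^ 3 = \<sigma>\<^sup>2 / (2 * l)" by (simp add: field_simps)
    then show ?thesis unfolding l_def using assms by (simp add: power2_eq_square field_simps)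
  qed
  also have "\<dots> \<le> (\<integral>x. (X x)\<^sup>2 / l - X x ^ 4 / l ^ 3 \<partial>M)"
    using assms l by (simp add: divide_right_mono)
  also have "\<dots> \<le> (\<integral>x. \<bar>X x\<bar> \<partial>M)"
    using assms by (intro integral_mono pt) auto
  finally show ?thesis .
qed

lemma (in prob_space) square_mean_le:
  fixes Z :: "'a \<Rightarrow> real"
  assumes "integrable M Z" "integrable M (\<lambda>x. (Z x)\<^sup>2)"
  shows "(\<integral>x. Z x \<partial>M) \<le> sqrt (\<integral>x. (Z x)\<^sup>2 \<partial>M)"
  using variance_eq[OF assms] variance_positive[of Z] by (intro real_le_rsqrt) simp

section \<open>Log-concave tails and the fourth moment\<close>

text \<open>
  For a log-concave sequence the ratio of consecutive terms decreases, so a first ratio of at most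
  \<open>1/3\<close> persists. Monotonicity handles a vanishing term, where the ratio is meaningless.
\<close>

lemma geometric_decay_of_log_concave:
  fixes G :: "nat \<Rightarrow> real"
  assumes nonneg: "\<And>k. 0 \<le> G k" and lc: "\<And>k. G k * G (k + 2) \<le> (G (k + 1))\<^sup>2"
    and "antimono G" "G 0 \<le> 1" "3 * G 1 \<le> G 0"
  shows "G k \<le> (1 / 3) ^ k"
proof -
  have ratio: "3 * G (Suc k) \<le> G k" for k
  proof (induction k)
    case 0
    then show ?case using assms by simp
  next
    case (Suc k)
    show ?case
    proof (cases "G (Suc k) = 0")
      case True
      then show ?thesis using antimonoD[OF \<open>antimono G\<close>, of "Suc k" "Suc (Suc k)"] by simp
    next
      case False
      then have pos: "0 < G (Suc k)" using nonneg[of "Suc k"] by simp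
      have "3 * G (Suc k) * G (Suc (Suc k)) \<le> G k * G (Suc (Suc k))"
        by (intro mult_right_mono Suc.IH nonneg)
      also have "\<dots> \<le> G (Suc k) * G (Suc k)" using lc[of k] by (simp add: power2_eq_square)
      finally show ?thesis using pos by (simp add: mult.assoc mult.left_commute)
    qed
  qed
  show ?thesis
  proof (induction k)
    case (Suc k)
    then show ?case using ratio[of k] by simp
  qed (use assms in simp)
qed

text \<open>
  The bound obtained by slicing the range of \<open>\<bar>X\<bar> / L\<close> into the intervals \<open>[4k - 2, 4k + 2]\<close>: on
  slice \<open>k\<close> the fourth power is at most \<open>(4k + 2)\<^sup>4\<close>, and the two tails together have
  probability at most \<open>2 / 3\<^sup>k\<close>.
\<close>

definition fourth_moment_const :: real
  where "fourth_moment_const = (\<Sum>k. 2 * (1 / 3) ^ k * (4 * real k + 2) ^ 4)"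

lemma fourth_moment_const_summable: "summable (\<lambda>k. 2 * (1 / 3) ^ k * (4 * real k + 2) ^ 4)"
proof (rule summable_comparison_test_ev)
  show "summable (\<lambda>k::nat. (1 / 2 :: real) ^ k)" by (rule summable_geometric) simp
  have "eventually (\<lambda>k. 2 * (1 / 3) ^ k * (4 * real k + 2) ^ 4 \<le> (1 / 2) ^ k) sequentially"
    by real_asymp
  then show "eventually (\<lambda>k. norm (2 * (1 / 3) ^ k * (4 * real k + 2) ^ 4) \<le> (1 / 2) ^ k) sequentially"
    by simp
qed

text \<open>
  Chebyshev's inequality gives the first ratio: the tail is at least \<open>3/4\<close> at \<open>-2L\<close> and at most
  \<open>1/4\<close> at \<open>2L\<close>. Points in arithmetic progression turn midpoint log-concavity of the tail into
  log-concavity of a sequence.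
\<close>

lemma (in prob_space) tail_decay:
  fixes X :: "'a \<Rightarrow> real"
  assumes [measurable]: "X \<in> borel_measurable M" and "integrable M (\<lambda>x. (X x)\<^sup>2)" "0 < L"
    and var: "(\<integral>x. (X x)\<^sup>2 \<partial>M) = L\<^sup>2"
    and lc: "\<And>a b. prob {x\<in>space M. a \<le> X x} * prob {x\<in>space M. b \<le> X x}
      \<le> (prob {x\<in>space M. (a + b) / 2 \<le> X x})\<^sup>2"
  shows "prob {x\<in>space M. (4 * real k - 2) * L \<le> X x} \<le> (1 / 3) ^ k"
proof (rule geometric_decay_of_log_concave)
  let ?G = "\<lambda>k::nat. prob {x\<in>space M. (4 * real k - 2) * L \<le> X x}"
  have cheb: "prob {x\<in>space M. 2 * L \<le> \<bar>X x\<bar>} \<le> 1 / 4"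
    using second_moment_method[of X "2 * L"] assms by (simp add: power2_eq_square)
  have "?G 1 \<le> prob {x\<in>space M. 2 * L \<le> \<bar>X x\<bar>}"
    by (intro finite_measure_mono) auto
  with cheb have 1: "?G 1 \<le> 1 / 4" by simp
  have "1 - ?G 0 = prob {x\<in>space M. \<not> (4 * real 0 - 2) * L \<le> X x}"
    by (subst prob_neg) auto
  also have "\<dots> \<le> prob {x\<in>space M. 2 * L \<le> \<bar>X x\<bar>}"
    by (intro finite_measure_mono) auto
  finally show "3 * ?G 1 \<le> ?G 0" using 1 cheb by linarith
  show "?G k * ?G (k + 2) \<le> (?G (k + 1))\<^sup>2" for k
  proof -
    have "((4 * real k - 2) * L + (4 * real (k + 2) - 2) * L) / 2 = (4 * real (k + 1) - 2) * L"
      by (simp add: field_simps)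
    with lc[of "(4 * real k - 2) * L" "(4 * real (k + 2) - 2) * L"] show ?thesis by simp
  qed
  show "antimono ?G"
  proof (rule antimonoI)
    fix i j :: nat assume "i \<le> j"
    then have "(4 * real i - 2) * L \<le> (4 * real j - 2) * L"
      using assms by (intro mult_right_mono) auto
    then show "?G j \<le> ?G i" by (intro finite_measure_mono) auto
  qed
qed auto

text \<open>
  A reverse Hoelder inequality: every variable with log-concave upper and lower tails has its fourth
  moment controlled by the square of its second moment, with a universal constant.
\<close>

lemma (in prob_space) fourth_moment_bound:
  fixes X :: "'a \<Rightarrow> real"
  assumes [measurable]: "X \<in> borel_measurable M" and X2: "integrable M (\<lambda>x. (X x)\<^sup>2)"
    and X4: "integrable M (\<lambda>x. X x ^ 4)" and L: "0 < L" 
    and var: "(\<integral>x. (X x)\<^sup>2 \<partial>M) = L\<^sup>2"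
    and lc: "\<And>a b. prob {x\<in>space M. a \<le> X x} * prob {x\<in>space M. b \<le> X x}
      \<le> (prob {x\<in>space M. (a + b) / 2 \<le> X x})\<^sup>2"
    and lc': "\<And>a b. prob {x\<in>space M. a \<le> - X x} * prob {x\<in>space M. b \<le> - X x}
      \<le> (prob {x\<in>space M. (a + b) / 2 \<le> - X x})\<^sup>2"
  shows "(\<integral>x. X x ^ 4 \<partial>M) \<le> fourth_moment_const * L ^ 4"
proof -
  let ?A = "\<lambda>k::nat. {x\<in>space M. (4 * real k - 2) * L \<le> \<bar>X x\<bar>}"
  let ?c = "\<lambda>k::nat. ((4 * real k + 2) * L) ^ 4"
  have PA: "prob (?A k) \<le> 2 * (1 / 3) ^ k" for k
  proof -
    have "prob (?A k) \<le> prob {x\<in>space M. (4 * real k - 2) * L \<le> X x} + prob {x\<in>space M. (4 * real k - 2) * L \<le> - X x}"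
      by (rule order_trans[OF finite_measure_mono measure_Un_le]) auto
    also have "\<dots> \<le> (1 / 3) ^ k + (1 / 3) ^ k"
      using assms by (intro add_mono tail_decay) auto
    finally show ?thesis by simp
  qed
  have pt: "ennreal (X x ^ 4) \<le> (\<Sum>k. ennreal (?c k) * indicator (?A k) x)" if x: "x \<in> space M" for x
  proof -
    \<comment> \<open>The index of the slice \<open>[4k - 2, 4k + 2)\<close> that contains \<open>\<bar>X x\<bar> / L\<close>.\<close>
    define k where "k = nat \<lfloor>(\<bar>X x\<bar> / L + 2) / 4\<rfloor>"
    have "0 \<le> (\<bar>X x\<bar> / L + 2) / 4" using L by auto
    then have "real k \<le> (\<bar>X x\<bar> / L + 2) / 4" "(\<bar>X x\<bar> / L + 2) / 4 < real k + 1"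
      unfolding k_def by linarith+
    then have k: "(4 * real k - 2) * L \<le> \<bar>X x\<bar>" "\<bar>X x\<bar> \<le> (4 * real k + 2) * L"
      using L by (auto simp: field_simps)
    then have "X x ^ 4 \<le> ?c k"
      using power_mono[of "\<bar>X x\<bar>" "(4 * real k + 2) * L" 4] by simp
    then have "ennreal (X x ^ 4) \<le> ennreal (?c k) * indicator (?A k) x"
      using k x by (simp add: ennreal_leI)
    also have "\<dots> = (\<Sum>k\<in>{k}. ennreal (?c k) * indicator (?A k) x)"
      by (simp only: sum.insert finite.emptyI sum.empty empty_iff not_False_eq_True add_0_right)
    also have "\<dots> \<le> (\<Sum>k. ennreal (?c k) * indicator (?A k) x)"
      by (rule sum_le_suminf) auto
    finally show ?thesis .
  qed
  have "ennreal (\<integral>x. X x ^ 4 \<partial>M) = (\<integral>\<^sup>+x. ennreal (X x ^ 4) \<partial>M)"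
    using X4 by (intro nn_integral_eq_integral[symmetric]) auto
  also have "\<dots> \<le> (\<integral>\<^sup>+x. (\<Sum>k. ennreal (?c k) * indicator (?A k) x) \<partial>M)"
    by (intro nn_integral_mono pt)
  also have "\<dots> = (\<Sum>k. \<integral>\<^sup>+x. ennreal (?c k) * indicator (?A k) x \<partial>M)"
    by (intro nn_integral_suminf) measurable
  also have "\<dots> = (\<Sum>k. ennreal (?c k) * emeasure M (?A k))"
    by (subst nn_integral_cmult_indicator) auto
  also have "\<dots> \<le> (\<Sum>k. ennreal (2 * (1 / 3) ^ k * (4 * real k + 2) ^ 4 * L ^ 4))"
  proof (intro suminf_le)
    fix k
    have "ennreal (?c k) * emeasure M (?A k) = ennreal (?c k * prob (?A k))"
      by (simp add: emeasure_eq_measure ennreal_mult)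
    also have "\<dots> \<le> ennreal (?c k * (2 * (1 / 3) ^ k))"
      using L PA[of k] by (intro ennreal_leI mult_left_mono) auto
    also have "?c k * (2 * (1 / 3) ^ k) = 2 * (1 / 3) ^ k * (4 * real k + 2) ^ 4 * L ^ 4"
      by (simp add: power_mult_distrib)
    finally show "ennreal (?c k) * emeasure M (?A k) \<le> ennreal (2 * (1 / 3) ^ k * (4 * real k + 2) ^ 4 * L ^ 4)" .
  qed auto
  also have "\<dots> = ennreal (\<Sum>k. 2 * (1 / 3) ^ k * (4 * real k + 2) ^ 4 * L ^ 4)"
    using L fourth_moment_const_summable by (intro suminf_ennreal2 summable_mult2) auto
  also have "(\<Sum>k. 2 * (1 / 3) ^ k * (4 * real k + 2) ^ 4 * L ^ 4) = fourth_moment_const * L ^ 4"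
    unfolding fourth_moment_const_def using fourth_moment_const_summable by (rule suminf_mult2[symmetric])
  finally show ?thesis
    by (subst (asm) ennreal_le_iff)
      (auto simp: fourth_moment_const_def intro!: mult_nonneg_nonneg suminf_nonneg fourth_moment_const_summable)
qed

section \<open>Powers of a uniform distribution\<close>

text \<open>
  The iterated integral over \<open>C\<close> is the expectation over independent samples from \<open>C\<close>. Both
  measures agree on boxes, which determines them.
\<close>

lemma PiM_density_indicator:
  fixes s :: nat
  assumes "sigma_finite_measure M" and C[measurable]: "C \<in> sets M"
    and fin: "emeasure M C < \<infinity>"
  shows "PiM {..<s} (\<lambda>_. density M (indicator C))
    = density (PiM {..<s} (\<lambda>_. M)) (indicator (PiE {..<s} (\<lambda>_. C)))"
proof -
  interpret sigma_finite_measure M by fact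
  interpret product_sigma_finite "\<lambda>_::nat. M" by standard
  let ?Q = "density M (indicator C)"
  have Qe: "emeasure ?Q A = emeasure M (C \<inter> A)" if "A \<in> sets M" for A
    using that by (simp add: emeasure_density indicator_inter_arith[symmetric])
  have "finite_measure ?Q"
  proof (rule finite_measureI)
    have "emeasure ?Q (space ?Q) = emeasure M (C \<inter> space M)"
      by (simp only: space_density Qe sets.top)
    also have "C \<inter> space M = C" by (rule sets.Int_space_eq2[OF C])
    finally show "emeasure ?Q (space ?Q) \<noteq> \<infinity>" using fin by simp
  qed
  then have Q: "product_sigma_finite (\<lambda>_::nat. ?Q)"
    by (simp add: product_sigma_finite_def finite_measure.axioms(1))
  show ?thesis
  proof (rule product_sigma_finite.PiM_eqI[OF Q, symmetric])
    show "sets (density (PiM {..<s} (\<lambda>_. M)) (indicator (PiE {..<s} (\<lambda>_. C)))) = sets (PiM {..<s} (\<lambda>_. ?Q))"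
      unfolding sets_density by (rule sets_PiM_cong) simp_all
    fix A :: "nat \<Rightarrow> 'a set" assume "\<And>i. i \<in> {..<s} \<Longrightarrow> A i \<in> sets ?Q"
    then have A: "\<And>i. i < s \<Longrightarrow> A i \<in> sets M" by simp
    have m: "PiE {..<s} A \<in> sets (PiM {..<s} (\<lambda>_. M))"
      "PiE {..<s} (\<lambda>_. C) \<in> sets (PiM {..<s} (\<lambda>_. M))"
      using A by (auto intro!: sets_PiM_I_finite)
    have "emeasure (density (PiM {..<s} (\<lambda>_. M)) (indicator (PiE {..<s} (\<lambda>_. C)))) (PiE {..<s} A)
       = emeasure (PiM {..<s} (\<lambda>_. M)) (PiE {..<s} (\<lambda>_. C) \<inter> PiE {..<s} A)"
      using m by (simp add: emeasure_density indicator_inter_arith[symmetric])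
    also have "PiE {..<s} (\<lambda>_. C) \<inter> PiE {..<s} A = PiE {..<s} (\<lambda>i. C \<inter> A i)"
      by (rule PiE_Int)
    also have "emeasure (PiM {..<s} (\<lambda>_. M)) \<dots> = (\<Prod>i<s. emeasure M (C \<inter> A i))"
      using A by (intro emeasure_PiM) auto
    also have "\<dots> = (\<Prod>i<s. emeasure ?Q (A i))" using A by (simp add: Qe)
    finally show "emeasure (density (PiM {..<s} (\<lambda>_. M)) (indicator (PiE {..<s} (\<lambda>_. C)))) (PiE {..<s} A)
       = (\<Prod>i<s. emeasure ?Q (A i))" .
  qed simp
qed

section \<open>Topology and measurability in coordinates\<close>

lemma topspace_Rn: "topspace (Rn n) = {..<n} \<rightarrow>\<^sub>E UNIV"
  by (simp add: Rn_def)

lemma space_vol: "space (vol n) = {..<n} \<rightarrow>\<^sub>E UNIV"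
  by (simp add: vol_def space_PiM)

lemma continuous_map_coordinate: "i < n \<Longrightarrow> continuous_map (Rn n) euclideanreal (\<lambda>x. x i)"
  unfolding Rn_def by (rule continuous_map_product_projection) simp

lemma compactin_attains_minimum:
  fixes f :: "'a \<Rightarrow> real"
  assumes "compactin X K" "K \<noteq> {}" "continuous_map X euclideanreal f"
  obtains p where "p \<in> K" "\<And>x. x \<in> K \<Longrightarrow> f p \<le> f x"
proof -
  have "compact (f ` K)" using image_compactin[OF assms(1,3)] by simp
  then show ?thesis
    using compact_attains_inf[of "f ` K"] assms(2) that by auto
qed

lemma compactin_bounded_coordinates:
  assumes "compactin (Rn n) K"
  obtains b where "0 < b" "\<And>x i. x \<in> K \<Longrightarrow> i < n \<Longrightarrow> \<bar>x i\<bar> \<le> b"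
proof -
  have "\<exists>c. \<forall>x\<in>K. \<bar>x i\<bar> \<le> c" if "i < n" for i
  proof -
    have "compact ((\<lambda>x. x i) ` K)"
      using image_compactin[OF assms continuous_map_coordinate[OF that]] by simp
    then show ?thesis
      using compact_imp_bounded[of "(\<lambda>x. x i) ` K"] unfolding bounded_real by auto
  qed
  then obtain c where c: "\<And>i x. i < n \<Longrightarrow> x \<in> K \<Longrightarrow> \<bar>x i\<bar> \<le> c i" by metis
  show ?thesis
  proof (rule that[of "1 + (\<Sum>i<n. \<bar>c i\<bar>)"])
    show "0 < 1 + (\<Sum>i<n. \<bar>c i\<bar>)" by (simp add: add_pos_nonneg sum_nonneg)
    fix x i assume "x \<in> K" "i < n"
    then have "\<bar>x i\<bar> \<le> \<bar>c i\<bar>" using c[of i x] by linarith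
    also have "\<dots> \<le> (\<Sum>i<n. \<bar>c i\<bar>)" using \<open>i < n\<close> by (intro member_le_sum) auto
    finally show "\<bar>x i\<bar> \<le> 1 + (\<Sum>i<n. \<bar>c i\<bar>)" by simp
  qed
qed

text \<open>
  The full space of sequences of reals is a type with a countable basis, whose Borel sets are the
  product-measurable ones. An open set of extensional functions is transferred there along
  restriction and brought back by padding with zeros.
\<close>

lemma openin_Rn_measurable:
  assumes "openin (Rn n) U"
  shows "U \<in> sets (vol n)"
proof -
  let ?r = "\<lambda>x::nat \<Rightarrow> real. restrict x {..<n}" and ?e = "\<lambda>x i. if i < n then x i else (0::real)"
  have "continuous_map (product_topology (\<lambda>_::nat. euclideanreal) UNIV) (Rn n) ?r"
    unfolding Rn_def continuous_map_componentwise
    by (auto intro!: continuous_map_product_projection continuous_map_eq[OF continuous_map_product_projection])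
  from openin_continuous_map_preimage[OF this assms]
  have "open {x. ?r x \<in> U}" by (simp add: euclidean_product_topology)
  then have "{x. ?r x \<in> U} \<in> sets (PiM UNIV (\<lambda>_::nat. borel :: real measure))"
    by (simp add: sets_PiM_equal_borel)
  moreover have "?e \<in> vol n \<rightarrow>\<^sub>M PiM UNIV (\<lambda>_::nat. borel :: real measure)"
  proof (rule measurable_PiM_single')
    show "(\<lambda>x. ?e x i) \<in> vol n \<rightarrow>\<^sub>M borel" for i
      unfolding vol_def by (cases "i < n") (use measurable_component_singleton[of i "{..<n}" "\<lambda>_. lborel :: real measure"] in auto)
  qed auto
  ultimately have "?e -` {x. ?r x \<in> U} \<inter> space (vol n) \<in> sets (vol n)"
    by (rule measurable_sets[rotated])
  moreover have "?e -` {x. ?r x \<in> U} \<inter> space (vol n) = U"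
  proof -
    have "?r (?e x) = x" if "x \<in> {..<n} \<rightarrow>\<^sub>E UNIV" for x
      using that by (auto simp: fun_eq_iff PiE_def extensional_def restrict_def)
    moreover have "U \<subseteq> {..<n} \<rightarrow>\<^sub>E UNIV" using openin_subset[OF assms] by (simp add: topspace_Rn)
    ultimately show ?thesis by (auto simp: space_vol)
  qed
  ultimately show ?thesis by simp
qed

lemma compactin_Rn_measurable:
  assumes "compactin (Rn n) K"
  shows "K \<in> sets (vol n)"
proof -
  have "closedin (Rn n) K"
    using compactin_imp_closedin[OF _ assms] by (simp add: Rn_def Hausdorff_space_product_topology)
  then have "openin (Rn n) (topspace (Rn n) - K)" and K: "K \<subseteq> topspace (Rn n)"
    by (auto simp: closedin_def)
  have "space (vol n) - (topspace (Rn n) - K) \<in> sets (vol n)"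
    by (rule sets.compl_sets[OF openin_Rn_measurable[OF \<open>openin (Rn n) (topspace (Rn n) - K)\<close>]])
  also have "space (vol n) - (topspace (Rn n) - K) = K"
    using K by (auto simp: space_vol topspace_Rn)
  finally show ?thesis .
qed

lemma interior_of_Rn_contains_cube:
  assumes "(Rn n) interior_of K \<noteq> {}"
  obtains w e where "w \<in> K" "0 < e"
    "\<And>x. x \<in> {..<n} \<rightarrow>\<^sub>E UNIV \<Longrightarrow> (\<And>i. i < n \<Longrightarrow> \<bar>x i - w i\<bar> < e) \<Longrightarrow> x \<in> K"
proof -
  obtain w where w: "w \<in> (Rn n) interior_of K" using assms by blast
  have "openin (product_topology (\<lambda>_. euclideanreal) {..<n}) ((Rn n) interior_of K)"
    using openin_interior_of[of "Rn n" K] by (simp add: Rn_def)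
  then obtain U where "\<forall>i\<in>{..<n}. openin euclideanreal (U i)" and U: "w \<in> PiE {..<n} U"
    "PiE {..<n} U \<subseteq> (Rn n) interior_of K"
    using w unfolding openin_product_topology_alt by blast
  then have opn: "open (U i)" if "i < n" for i using that by simp
  have "\<exists>e>0. \<forall>t. \<bar>t - w i\<bar> < e \<longrightarrow> t \<in> U i" if "i < n" for i
  proof -
    have "w i \<in> U i" using U(1) that by auto
    with opn[OF that] show ?thesis unfolding open_dist dist_real_def by blast
  qed
  then obtain e where e: "\<And>i. i < n \<Longrightarrow> 0 < e i" "\<And>i t. i < n \<Longrightarrow> \<bar>t - w i\<bar> < e i \<Longrightarrow> t \<in> U i"
    by metis
  let ?e = "Min (insert 1 (e ` {..<n}))"
  have sub: "(Rn n) interior_of K \<subseteq> K" by (rule interior_of_subset)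
  show ?thesis
  proof (rule that[of w ?e])
    show "w \<in> K" using w sub by blast
    show "0 < ?e" using e(1) by (subst Min_gr_iff) auto
    fix x :: "nat \<Rightarrow> real" assume x: "x \<in> {..<n} \<rightarrow>\<^sub>E UNIV" "\<And>i. i < n \<Longrightarrow> \<bar>x i - w i\<bar> < ?e"
    have "?e \<le> e i" if "i < n" for i using that by (intro Min_le) auto
    then have "x i \<in> U i" if "i < n" for i using e(2)[OF that] x(2)[OF that] that by (meson less_le_trans)
    then have "x \<in> PiE {..<n} U" using x(1) by (auto simp: PiE_iff)
    then show "x \<in> K" using U(2) sub by blast
  qed
qed

section \<open>Polar body and gauge of a symmetric convex body\<close>

text \<open>
  The functional is \<open>z - p\<close>, where \<open>p\<close> is the point of \<open>K\<close> nearest to \<open>z\<close>: moving from \<open>p\<close> towards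
  another point of \<open>K\<close> cannot decrease the distance to \<open>z\<close>, so the first-order term in the
  displacement has a sign.
\<close>

lemma separating_functional:
  assumes "compactin (Rn n) K" "convex_set n K" "K \<noteq> {}"
    and z: "z \<in> {..<n} \<rightarrow>\<^sub>E UNIV" "z \<notin> K"
  obtains y c where "y \<in> {..<n} \<rightarrow>\<^sub>E UNIV" "\<And>x. x \<in> K \<Longrightarrow> inner_vec n x y \<le> c" "c < inner_vec n z y"
proof -
  have cont: "continuous_map (Rn n) euclideanreal (\<lambda>x. \<Sum>i<n. (x i - z i)\<^sup>2)"
    by (intro continuous_map_sum continuous_map_real_pow continuous_map_diff continuous_map_coordinate) auto
  obtain p where p: "p \<in> K" "\<And>x. x \<in> K \<Longrightarrow> (\<Sum>i<n. (p i - z i)\<^sup>2) \<le> (\<Sum>i<n. (x i - z i)\<^sup>2)"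
    using compactin_attains_minimum[OF assms(1,3) cont] by blast
  have KE: "K \<subseteq> {..<n} \<rightarrow>\<^sub>E UNIV" using compactin_subset_topspace[OF assms(1)] by (simp add: topspace_Rn)
  define y where "y = (\<lambda>i\<in>{..<n}. z i - p i)"
  have in_y: "inner_vec n x y = (\<Sum>i<n. x i * (z i - p i))" for x
    by (simp add: inner_vec_def y_def)
  show ?thesis
  proof (rule that[of y "inner_vec n p y"])
    show "y \<in> {..<n} \<rightarrow>\<^sub>E UNIV" by (simp add: y_def)
    obtain i where i: "i < n" "z i \<noteq> p i"
      using z p(1) KE by (metis PiE_ext lessThan_iff subsetD)
    have "0 < (\<Sum>i<n. (z i - p i)\<^sup>2)"
      using i by (intro sum_pos2[of _ i]) auto
    also have "\<dots> = inner_vec n z y - inner_vec n p y"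
      by (simp add: in_y sum_subtractf[symmetric] power2_eq_square algebra_simps)
    finally show "inner_vec n p y < inner_vec n z y" by simp
    fix x assume x: "x \<in> K"
    define A where "A = (\<Sum>i<n. (p i - z i) * (x i - p i))"
    define B where "B = (\<Sum>i<n. (x i - p i)\<^sup>2)"
    have B: "0 \<le> B" by (simp add: B_def sum_nonneg)
    have variation: "- (u * B) \<le> 2 * A" if u: "0 < u" "u \<le> 1" for u
    proof -
      have "add_vec n (scale_vec n u x) (scale_vec n (1 - u) p) \<in> K"
        using assms(2) x p(1) u unfolding convex_set_def by auto
      from p(2)[OF this] have "(\<Sum>i<n. (p i - z i)\<^sup>2) \<le> (\<Sum>i<n. (u * x i + (1 - u) * p i - z i)\<^sup>2)"
        by (simp add: add_vec_def scale_vec_def)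
      also have "\<dots> = (\<Sum>i<n. (p i - z i)\<^sup>2 + u * (2 * ((p i - z i) * (x i - p i)) + u * (x i - p i)\<^sup>2))"
        by (intro sum.cong) (auto simp: power2_eq_square algebra_simps)
      also have "\<dots> = (\<Sum>i<n. (p i - z i)\<^sup>2) + u * (2 * A + u * B)"
        by (simp add: sum.distrib sum_distrib_left distrib_left A_def B_def)
      finally have "0 \<le> u * (2 * A + u * B)" by simp
      with u have "0 \<le> 2 * A + u * B" by (simp add: zero_le_mult_iff)
      then show ?thesis by simp
    qed
    have "0 \<le> A"
    proof (rule ccontr)
      assume "\<not> 0 \<le> A"
      then have A: "A < 0" by simp
      \<comment> \<open>A step so short that the quadratic term cannot compensate the negative linear one.\<close>
      define u where "u = min 1 (- A / (B + 1))"
      have u: "0 < u" "u \<le> 1" using A B by (auto simp: u_def divide_neg_pos)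
      have "u * B \<le> (- A / (B + 1)) * B" using B by (intro mult_right_mono) (auto simp: u_def)
      also have "\<dots> \<le> - A" using A B by (simp add: field_simps mult_nonpos_nonneg)
      finally show False using variation[OF u] A by linarith
    qed
    then show "inner_vec n x y \<le> inner_vec n p y"
      by (simp add: in_y A_def algebra_simps sum_subtractf sum.distrib)
  qed
qed

lemma abs_inner_vec_le: "\<bar>inner_vec n x y\<bar> \<le> L2_set x {..<n} * L2_set y {..<n}"
proof -
  have "\<bar>inner_vec n x y\<bar> \<le> (\<Sum>i<n. \<bar>x i\<bar> * \<bar>y i\<bar>)"
    unfolding inner_vec_def by (rule order_trans[OF sum_abs]) (simp add: abs_mult)
  then show ?thesis using L2_set_mult_ineq[of x y "{..<n}"] by linarith
qed

lemma inner_scale_right: "inner_vec n x (scale_vec n r y) = r * inner_vec n x y"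
  by (simp add: inner_vec_def scale_vec_def sum_distrib_left ac_simps)

lemma inner_scale_left: "inner_vec n (scale_vec n r x) y = r * inner_vec n x y"
  by (simp add: inner_vec_def scale_vec_def sum_distrib_left ac_simps)

lemma L2_scale: "L2_set (scale_vec n r x) {..<n} = \<bar>r\<bar> * L2_set x {..<n}"
proof -
  have "L2_set (scale_vec n r x) {..<n} = sqrt (r\<^sup>2 * (\<Sum>i<n. (x i)\<^sup>2))"
    by (simp add: L2_set_def scale_vec_def power_mult_distrib sum_distrib_left)
  then show ?thesis by (simp add: real_sqrt_mult L2_set_def)
qed

lemma scale_in_space: "scale_vec n r x \<in> {..<n} \<rightarrow>\<^sub>E UNIV"
  by (simp add: scale_vec_def)

lemma scale_scale: "scale_vec n r (scale_vec n q x) = scale_vec n (r * q) x"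
  by (auto simp: scale_vec_def fun_eq_iff)

lemma scale_one: "x \<in> {..<n} \<rightarrow>\<^sub>E UNIV \<Longrightarrow> scale_vec n 1 x = x"
  by (auto simp: scale_vec_def fun_eq_iff PiE_def extensional_def)

lemma mem_scale_image:
  assumes "K \<subseteq> {..<n} \<rightarrow>\<^sub>E UNIV" "r \<noteq> 0" "x \<in> {..<n} \<rightarrow>\<^sub>E UNIV"
  shows "x \<in> scale_vec n r ` K \<longleftrightarrow> scale_vec n (1 / r) x \<in> K"
proof
  assume "x \<in> scale_vec n r ` K"
  then show "scale_vec n (1 / r) x \<in> K" using assms by (auto simp: scale_scale scale_one subset_eq)
next
  assume "scale_vec n (1 / r) x \<in> K"
  then have "scale_vec n r (scale_vec n (1 / r) x) \<in> scale_vec n r ` K" by (rule imageI)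
  then show "x \<in> scale_vec n r ` K" using assms by (simp add: scale_scale scale_one)
qed

locale symmetric_convex_body =
  fixes n :: nat and K :: "(nat \<Rightarrow> real) set"
  assumes dim: "1 \<le> n" and body: "convex_body n K" and sym: "centrally_symmetric n K"
begin

lemma compactK: "compactin (Rn n) K" and convexK: "convex_set n K"
  using body by (auto simp: convex_body_def)

lemma subset_space: "K \<subseteq> {..<n} \<rightarrow>\<^sub>E UNIV"
  using compactin_subset_topspace[OF compactK] by (simp add: topspace_Rn)

lemma uminus_mem: "x \<in> K \<Longrightarrow> scale_vec n (-1) x \<in> K"
  using sym by (auto simp: centrally_symmetric_def)

text \<open>
  If \<open>K\<close> contains a small cube around \<open>w\<close>, it contains its reflection by symmetry and, by convexity,
  the midpoints of opposite points, which fill a cube around the origin.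
\<close>

lemma contains_cube:
  obtains d where "0 < d" "\<And>x. x \<in> {..<n} \<rightarrow>\<^sub>E UNIV \<Longrightarrow> (\<And>i. i < n \<Longrightarrow> \<bar>x i\<bar> \<le> d) \<Longrightarrow> x \<in> K"
proof -
  obtain w e where w: "w \<in> K" "0 < e"
    "\<And>x. x \<in> {..<n} \<rightarrow>\<^sub>E UNIV \<Longrightarrow> (\<And>i. i < n \<Longrightarrow> \<bar>x i - w i\<bar> < e) \<Longrightarrow> x \<in> K"
    using interior_of_Rn_contains_cube[of n K] body unfolding convex_body_def by blast
  show ?thesis
  proof (rule that[of "e / 4"])
    show "0 < e / 4" using w by simp
    fix x :: "nat \<Rightarrow> real" assume x: "x \<in> {..<n} \<rightarrow>\<^sub>E UNIV" "\<And>i. i < n \<Longrightarrow> \<bar>x i\<bar> \<le> e / 4"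
    let ?q = "\<lambda>i\<in>{..<n}. 2 * x i + w i"
    have "?q \<in> K"
    proof (rule w(3))
      show "\<bar>?q i - w i\<bar> < e" if "i < n" for i using x(2)[OF that] w(2) that by simp
    qed simp
    with uminus_mem[OF w(1)] have "add_vec n (scale_vec n (1/2) ?q) (scale_vec n (1/2) (scale_vec n (-1) w)) \<in> K"
      using convexK unfolding convex_set_def by auto
    also have "add_vec n (scale_vec n (1/2) ?q) (scale_vec n (1/2) (scale_vec n (-1) w)) = x"
      using x(1) by (auto simp: add_vec_def scale_vec_def fun_eq_iff PiE_def extensional_def add_divide_distrib)
    finally show "x \<in> K" .
  qed
qed

lemma zero_mem: "scale_vec n 0 x \<in> K"
proof -
  obtain d where "0 < d" "\<And>x. x \<in> {..<n} \<rightarrow>\<^sub>E UNIV \<Longrightarrow> (\<And>i. i < n \<Longrightarrow> \<bar>x i\<bar> \<le> d) \<Longrightarrow> x \<in> K"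
    using contains_cube by blast
  then show ?thesis by (auto simp: scale_vec_def)
qed

lemma shrink_mem: "x \<in> K \<Longrightarrow> 0 \<le> r \<Longrightarrow> r \<le> 1 \<Longrightarrow> scale_vec n r x \<in> K"
proof -
  assume *: "x \<in> K" "0 \<le> r" "r \<le> 1"
  then have "add_vec n (scale_vec n r x) (scale_vec n (1 - r) (scale_vec n 0 x)) \<in> K"
    using convexK zero_mem unfolding convex_set_def by auto
  also have "add_vec n (scale_vec n r x) (scale_vec n (1 - r) (scale_vec n 0 x)) = scale_vec n r x"
    by (auto simp: add_vec_def scale_vec_def fun_eq_iff)
  finally show ?thesis .
qed

lemma polar_bounded: "bdd_above ((\<lambda>y. L2_set y {..<n}) ` polar n K)"
proof -
  obtain d where d: "0 < d" "\<And>x. x \<in> {..<n} \<rightarrow>\<^sub>E UNIV \<Longrightarrow> (\<And>i. i < n \<Longrightarrow> \<bar>x i\<bar> \<le> d) \<Longrightarrow> x \<in> K"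
    using contains_cube by blast
  have "L2_set y {..<n} \<le> 1 / d" if y: "y \<in> polar n K" for y
  proof -
    \<comment> \<open>The vertex of the cube on which \<open>y\<close> is largest.\<close>
    let ?x = "\<lambda>i\<in>{..<n}. d * sgn (y i)"
    have "?x \<in> K" using d by (auto simp: abs_mult abs_sgn_eq)
    then have "inner_vec n ?x y \<le> 1" using y by (simp add: polar_def)
    also have "inner_vec n ?x y = d * (\<Sum>i<n. \<bar>y i\<bar>)"
      by (simp add: inner_vec_def sum_distrib_left abs_sgn ac_simps)
    finally have "(\<Sum>i<n. \<bar>y i\<bar>) \<le> 1 / d" using d by (simp add: field_simps)
    then show ?thesis using L2_set_le_sum_abs[of y "{..<n}"] by linarith
  qed
  then show ?thesis by (auto intro!: bdd_aboveI)
qed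

lemma polar_nontrivial: obtains y where "y \<in> polar n K" "0 < L2_set y {..<n}"
proof -
  obtain b where b: "0 < b" "\<And>x i. x \<in> K \<Longrightarrow> i < n \<Longrightarrow> \<bar>x i\<bar> \<le> b"
    using compactin_bounded_coordinates[OF compactK] by blast
  let ?y = "\<lambda>i\<in>{..<n}. if i = 0 then 1 / b else 0"
  have in_y: "inner_vec n x ?y = x 0 / b" for x
  proof -
    have "inner_vec n x ?y = (\<Sum>i<n. if i = 0 then x 0 / b else 0)"
      unfolding inner_vec_def by (intro sum.cong) auto
    then show ?thesis using dim by (simp add: sum.delta)
  qed
  show ?thesis
  proof (rule that[of ?y])
    have "x 0 / b \<le> 1" if "x \<in> K" for x using b(2)[OF that, of 0] b(1) dim by (simp add: field_simps)
    then show "?y \<in> polar n K" by (simp add: polar_def topspace_Rn in_y)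
    have "L2_set ?y {..<n} \<noteq> 0" using dim b by (subst L2_set_eq_0_iff) (auto intro!: bexI[of _ 0])
    then show "0 < L2_set ?y {..<n}" by (simp add: less_le)
  qed
qed

text \<open>
  The supremum of the norm over the polar body. It is finite and positive, so that the
  least admissible radius exists and equals it (\<open>radius_polar\<close>).
\<close>

definition R :: real where "R = (SUP y\<in>polar n K. L2_set y {..<n})"

lemma polar_norm_le: "y \<in> polar n K \<Longrightarrow> L2_set y {..<n} \<le> R"
  unfolding R_def by (rule cSUP_upper[OF _ polar_bounded])

lemma R_pos: "0 < R"
  using polar_nontrivial polar_norm_le by (metis less_le_trans)

lemma R_least: "(\<And>y. y \<in> polar n K \<Longrightarrow> L2_set y {..<n} \<le> r) \<Longrightarrow> R \<le> r"
  unfolding R_def using polar_nontrivial by (intro cSUP_least) auto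

lemma radius_polar: "radius n (polar n K) = R"
  unfolding radius_def
proof (rule Least_equality)
  have ball: "unit_ball n \<subseteq> {..<n} \<rightarrow>\<^sub>E UNIV" by (auto simp: unit_ball_def topspace_Rn)
  have polE: "polar n K \<subseteq> {..<n} \<rightarrow>\<^sub>E UNIV" by (auto simp: polar_def topspace_Rn)
  have iff: "polar n K \<subseteq> scale_vec n r ` unit_ball n \<longleftrightarrow> (\<forall>y\<in>polar n K. L2_set y {..<n} \<le> r)" if "0 < r" for r
  proof -
    have "y \<in> scale_vec n r ` unit_ball n \<longleftrightarrow> L2_set y {..<n} \<le> r" if "y \<in> polar n K" for y
      using mem_scale_image[OF ball, of r y] \<open>0 < r\<close> that polE
      by (auto simp: unit_ball_def topspace_Rn L2_scale scale_in_space field_simps)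
    then show ?thesis by blast
  qed
  show "0 < R \<and> polar n K \<subseteq> scale_vec n R ` unit_ball n"
    using R_pos iff polar_norm_le by blast
  show "R \<le> r" if "0 < r \<and> polar n K \<subseteq> scale_vec n r ` unit_ball n" for r
    using that iff by (intro R_least) auto
qed

text \<open>
  This is the part of the bipolar theorem that is needed: a functional separating \<open>x\<close> from \<open>K\<close>,
  normalised to lie in the polar body, would have norm greater than \<open>R\<close>. The threshold \<open>m\<close> for the
  normalisation lies strictly between the supremum of the functional on \<open>K\<close> and its value at \<open>x\<close>,
  because the former may be zero.
\<close>

lemma ball_subset:
  assumes x: "x \<in> {..<n} \<rightarrow>\<^sub>E UNIV" "L2_set x {..<n} \<le> 1 / R"
  shows "x \<in> K"
proof (rule ccontr)
  assume "x \<notin> K"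
  have "K \<noteq> {}" using zero_mem by blast
  from separating_functional[OF compactK convexK this x(1) \<open>x \<notin> K\<close>]
  obtain y c where y: "y \<in> {..<n} \<rightarrow>\<^sub>E UNIV" "\<And>w. w \<in> K \<Longrightarrow> inner_vec n w y \<le> c" "c < inner_vec n x y"
    by blast
  have "0 \<le> c" using y(2)[OF zero_mem[of x]] by (simp add: inner_scale_left)
  define m where "m = (c + inner_vec n x y) / 2"
  have m: "0 < m" "c < m" "m < inner_vec n x y" using y(3) \<open>0 \<le> c\<close> by (auto simp: m_def)
  have "scale_vec n (1 / m) y \<in> polar n K"
    using y(2) m by (auto simp: polar_def topspace_Rn scale_in_space inner_scale_right field_simps intro: order_trans less_imp_le)
  from polar_norm_le[OF this] have "L2_set y {..<n} \<le> R * m" using m by (simp add: L2_scale field_simps)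
  then have "L2_set x {..<n} * L2_set y {..<n} \<le> (1 / R) * (R * m)"
    using x R_pos by (intro mult_mono) auto
  then have "inner_vec n x y \<le> m" using abs_inner_vec_le[of n x y] R_pos by simp
  with m show False by simp
qed

lemma mem_scale:
  assumes "x \<in> {..<n} \<rightarrow>\<^sub>E UNIV" "0 < r" "R * L2_set x {..<n} \<le> r"
  shows "x \<in> scale_vec n r ` K"
proof -
  have "scale_vec n (1 / r) x \<in> K"
    using assms R_pos by (intro ball_subset) (auto simp: scale_in_space L2_scale field_simps)
  then show ?thesis using mem_scale_image[OF subset_space] assms by auto
qed

lemma gauge_set_bdd: "bdd_below {r. 0 < r \<and> x \<in> scale_vec n r ` K}"
  by (auto intro!: bdd_belowI[of _ 0])

lemma gauge_set_nonempty: "x \<in> {..<n} \<rightarrow>\<^sub>E UNIV \<Longrightarrow> {r. 0 < r \<and> x \<in> scale_vec n r ` K} \<noteq> {}"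
proof -
  assume x: "x \<in> {..<n} \<rightarrow>\<^sub>E UNIV"
  have "0 < R * L2_set x {..<n} + 1" using R_pos by (intro add_nonneg_pos mult_nonneg_nonneg) auto
  with mem_scale[OF x this] show ?thesis by auto
qed

lemma gauge_le:
  assumes "x \<in> {..<n} \<rightarrow>\<^sub>E UNIV"
  shows "gauge_norm n K x \<le> R * L2_set x {..<n}"
proof (rule field_le_epsilon)
  fix e :: real assume "0 < e"
  have "0 \<le> R * L2_set x {..<n}" using R_pos by simp
  then show "gauge_norm n K x \<le> R * L2_set x {..<n} + e"
    unfolding gauge_norm_def using mem_scale[OF assms, of "R * L2_set x {..<n} + e"] \<open>0 < e\<close>
    by (intro cInf_lower gauge_set_bdd) auto
qed

lemma gauge_ge:
  assumes x: "x \<in> {..<n} \<rightarrow>\<^sub>E UNIV" and y: "y \<in> polar n K"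
  shows "\<bar>inner_vec n x y\<bar> \<le> gauge_norm n K x"
  unfolding gauge_norm_def
proof (rule cInf_greatest[OF gauge_set_nonempty[OF x]])
  fix r assume "r \<in> {r. 0 < r \<and> x \<in> scale_vec n r ` K}"
  then obtain w where r: "0 < r" and w: "w \<in> K" "x = scale_vec n r w" by auto
  have "inner_vec n w y \<le> 1" "inner_vec n (scale_vec n (-1) w) y \<le> 1"
    using y w(1) uminus_mem[OF w(1)] by (auto simp: polar_def)
  then have "\<bar>inner_vec n w y\<bar> \<le> 1" by (simp add: inner_scale_left)
  then show "\<bar>inner_vec n x y\<bar> \<le> r"
    using r mult_left_mono[of "\<bar>inner_vec n w y\<bar>" 1 r] by (simp add: w(2) inner_scale_left abs_mult)
qed

lemma gauge_nonneg: "x \<in> {..<n} \<rightarrow>\<^sub>E UNIV \<Longrightarrow> 0 \<le> gauge_norm n K x"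
  unfolding gauge_norm_def by (intro cInf_greatest gauge_set_nonempty) auto

text \<open>
  Restricting to rational dilation factors, which is possible since the dilates of \<open>K\<close> increase,
  exhibits the sublevel sets of the gauge as countable unions.
\<close>

lemma gauge_less_iff:
  assumes x: "x \<in> {..<n} \<rightarrow>\<^sub>E UNIV"
  shows "gauge_norm n K x < a \<longleftrightarrow> (\<exists>q\<in>\<rat>. 0 < q \<and> q < a \<and> scale_vec n (1 / q) x \<in> K)"
proof
  assume "gauge_norm n K x < a"
  then obtain r where r: "0 < r" "x \<in> scale_vec n r ` K" "r < a"
    unfolding gauge_norm_def using cInf_less_iff[OF gauge_set_nonempty[OF x] gauge_set_bdd] by auto
  obtain q where q: "q \<in> \<rat>" "r < q" "q < a" using Rats_dense_in_real[OF r(3)] by blast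
  have "scale_vec n (1 / r) x \<in> K" using r mem_scale_image[OF subset_space _ x] by auto
  then have "scale_vec n (r / q) (scale_vec n (1 / r) x) \<in> K"
    by (rule shrink_mem) (use r(1) q in simp_all)
  then have "scale_vec n (1 / q) x \<in> K" using r by (simp add: scale_scale)
  then show "\<exists>q\<in>\<rat>. 0 < q \<and> q < a \<and> scale_vec n (1 / q) x \<in> K" using q r by (auto intro!: bexI[of _ q])
next
  assume "\<exists>q\<in>\<rat>. 0 < q \<and> q < a \<and> scale_vec n (1 / q) x \<in> K"
  then obtain q where q: "0 < q" "q < a" "x \<in> scale_vec n q ` K"
    using mem_scale_image[OF subset_space _ x] by force
  then have "gauge_norm n K x \<le> q"
    unfolding gauge_norm_def by (intro cInf_lower gauge_set_bdd) auto
  with q show "gauge_norm n K x < a" by simp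
qed

lemma scale_measurable: "scale_vec n r \<in> vol n \<rightarrow>\<^sub>M vol n"
proof -
  have "(\<lambda>x. \<lambda>i\<in>{..<n}. r * x i) \<in> vol n \<rightarrow>\<^sub>M PiM {..<n} (\<lambda>_. lborel)"
    unfolding vol_def by (intro measurable_restrict) measurable
  then show ?thesis unfolding scale_vec_def vol_def by simp
qed

lemma gauge_measurable: "gauge_norm n K \<in> borel_measurable (vol n)"
proof (rule borel_measurable_iff_less[THEN iffD2], rule allI)
  fix a
  have "{x \<in> space (vol n). gauge_norm n K x < a}
    = (\<Union>q\<in>{q\<in>\<rat>. 0 < q \<and> q < a}. scale_vec n (1 / q) -` K \<inter> space (vol n))"
    using gauge_less_iff by (auto simp: space_vol)
  also have "\<dots> \<in> sets (vol n)"
  proof (rule sets.countable_UN'')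
    show "countable {q \<in> \<rat>. 0 < q \<and> q < a}" by (rule countable_subset[OF _ countable_rat]) auto
    show "scale_vec n (1 / q) -` K \<inter> space (vol n) \<in> sets (vol n)" for q
      using scale_measurable compactin_Rn_measurable[OF compactK] by (rule measurable_sets)
  qed
  finally show "{x \<in> space (vol n). gauge_norm n K x < a} \<in> sets (vol n)" .
qed

end

section \<open>Linear combinations of vectors\<close>

lemma inner_vec_measurable[measurable]: "(\<lambda>x. inner_vec n x y) \<in> borel_measurable (vol n)"
  unfolding inner_vec_def vol_def
  by (intro borel_measurable_sum borel_measurable_times borel_measurable_const)
    (use measurable_component_singleton[of _ "{..<n}" "\<lambda>_. lborel :: real measure"] in auto)

lemma inner_vec_midpoint: "inner_vec n (\<lambda>i\<in>{..<n}. (x i + y i) / 2) z = (inner_vec n x z + inner_vec n y z) / 2"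
  by (simp add: inner_vec_def sum.distrib[symmetric] sum_divide_distrib algebra_simps add_divide_distrib)

lemma inner_lincomb: "inner_vec n (lincomb n s t x) y = (\<Sum>j<s. t j * inner_vec n (x j) y)"
proof -
  have "inner_vec n (lincomb n s t x) y = (\<Sum>i<n. \<Sum>j<s. t j * (x j i * y i))"
    by (simp add: inner_vec_def lincomb_def sum_distrib_right sum_distrib_left ac_simps)
  also have "\<dots> = (\<Sum>j<s. \<Sum>i<n. t j * (x j i * y i))" by (rule sum.swap)
  finally show ?thesis by (simp add: inner_vec_def sum_distrib_left)
qed

definition unit_vec :: "nat \<Rightarrow> nat \<Rightarrow> nat \<Rightarrow> real"
  where "unit_vec n i = (\<lambda>j\<in>{..<n}. if j = i then 1 else 0)"

lemma inner_unit_vec: "i < n \<Longrightarrow> inner_vec n x (unit_vec n i) = x i"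
proof -
  assume i: "i < n"
  have "inner_vec n x (unit_vec n i) = (\<Sum>j<n. if j = i then x j else 0)"
    unfolding inner_vec_def unit_vec_def by (intro sum.cong) auto
  then show ?thesis using i by (simp add: sum.delta')
qed

lemma unit_vec_in_sphere: "i < n \<Longrightarrow> unit_vec n i \<in> unit_sphere n"
proof -
  assume i: "i < n"
  have "(\<Sum>j<n. (unit_vec n i j)\<^sup>2) = (\<Sum>j<n. if j = i then 1 else 0)"
    unfolding unit_vec_def by (intro sum.cong) auto
  then show ?thesis using i by (simp add: unit_sphere_def topspace_Rn L2_set_def sum.delta') (simp add: unit_vec_def)
qed

lemma lincomb_measurable: "lincomb n s t \<in> PiM {..<s} (\<lambda>_. vol n) \<rightarrow>\<^sub>M vol n"
proof -
  have "(\<lambda>x. \<Sum>j<s. t j * x j i) \<in> borel_measurable (PiM {..<s} (\<lambda>_. vol n))" if "i < n" for i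
  proof (intro borel_measurable_sum borel_measurable_times borel_measurable_const)
    fix j assume j: "j \<in> {..<s}"
    have "(\<lambda>x. x i) \<in> borel_measurable (vol n)"
      unfolding vol_def using measurable_component_singleton[of i "{..<n}" "\<lambda>_. lborel :: real measure"] that by simp
    from measurable_compose[OF measurable_component_singleton[OF j] this]
    show "(\<lambda>x. x j i) \<in> borel_measurable (PiM {..<s} (\<lambda>_. vol n))" .
  qed
  then have "(\<lambda>x. \<lambda>i\<in>{..<n}. \<Sum>j<s. t j * x j i) \<in> PiM {..<s} (\<lambda>_. vol n) \<rightarrow>\<^sub>M PiM {..<n} (\<lambda>_. lborel)"
    by (intro measurable_restrict) simp
  then show ?thesis unfolding lincomb_def vol_def by simp
qed

lemma lincomb_in_space: "lincomb n s t x \<in> {..<n} \<rightarrow>\<^sub>E UNIV"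
  by (simp add: lincomb_def)

lemma sigma_finite_vol: "sigma_finite_measure (vol n)"
proof -
  interpret product_sigma_finite "\<lambda>_::nat. lborel :: real measure" by standard
  show ?thesis unfolding vol_def by (rule sigma_finite) simp
qed

section \<open>Random vectors in an isotropic body\<close>

text \<open>
  The isotropic constant is a parameter \<open>L\<close> here; \<open>isotropic_constant_eq\<close> identifies it with the
  definite description, whose uniqueness needs a nonempty sphere and hence \<open>n \<ge> 1\<close>.
\<close>

locale isotropic_body =
  fixes n :: nat and C :: "(nat \<Rightarrow> real) set" and L :: real
  assumes dim: "1 \<le> n" and body: "convex_body n C" and volume: "measure (vol n) C = 1"
    and bary: "barycenter n C = zero_vec n" and isoconst: "has_isotropic_constant n C L"
begin

lemma L_pos: "0 < L" using isoconst by (simp add: has_isotropic_constant_def)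

lemma isotropic_constant_eq: "isotropic_constant n C = L"
  unfolding isotropic_constant_def
proof (rule the_equality)
  show "has_isotropic_constant n C L" by (rule isoconst)
  fix L' assume "has_isotropic_constant n C L'"
  then have "0 < L'" "L'\<^sup>2 = L\<^sup>2"
    using isoconst unit_vec_in_sphere[of 0 n] dim unfolding has_isotropic_constant_def by auto
  then show "L' = L" using L_pos by (simp add: power2_eq_iff_nonneg)
qed

lemma C_measurable[measurable]: "C \<in> sets (vol n)"
  using body by (intro compactin_Rn_measurable) (simp add: convex_body_def)

lemma emeasure_C: "emeasure (vol n) C = 1"
proof -
  have "emeasure (vol n) C \<noteq> \<top>" using volume by (auto simp: measure_def)
  then show ?thesis using volume by (simp add: emeasure_eq_ennreal_measure)
qed

definition uniform :: "(nat \<Rightarrow> real) measure"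
  where "uniform = density (vol n) (indicator C)"

lemma space_uniform[simp]: "space uniform = space (vol n)"
  and sets_uniform[simp, measurable_cong]: "sets uniform = sets (vol n)"
  by (simp_all add: uniform_def)

lemma emeasure_uniform: "A \<in> sets (vol n) \<Longrightarrow> emeasure uniform A = emeasure (vol n) (C \<inter> A)"
  by (simp add: uniform_def emeasure_density indicator_inter_arith[symmetric])

sublocale prob_space uniform
proof
  have "C \<inter> space (vol n) = C" by (rule sets.Int_space_eq2[OF C_measurable])
  then show "emeasure uniform (space uniform) = 1"
    by (simp add: emeasure_uniform emeasure_C)
qed

lemma AE_uniform: "AE x in uniform. x \<in> C"
  unfolding uniform_def by (subst AE_density) (auto simp: indicator_def)

lemma integral_uniform:
  fixes f :: "(nat \<Rightarrow> real) \<Rightarrow> real"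
  assumes "f \<in> borel_measurable (vol n)"
  shows "(LINT x:C|vol n. f x) = (\<integral>x. f x \<partial>uniform)"
proof -
  have "uniform = density (vol n) (\<lambda>x. ennreal (indicator C x))"
    by (simp add: uniform_def ennreal_indicator)
  then show ?thesis
    unfolding set_lebesgue_integral_def using assms by (simp add: integral_density)
qed

lemma linear_functional_bounded:
  obtains b where "AE x in uniform. \<bar>inner_vec n x y\<bar> \<le> b"
proof -
  obtain b where b: "0 < b" "\<And>x i. x \<in> C \<Longrightarrow> i < n \<Longrightarrow> \<bar>x i\<bar> \<le> b"
    using compactin_bounded_coordinates[of n C] body unfolding convex_body_def by blast
  have "\<bar>inner_vec n x y\<bar> \<le> (\<Sum>i<n. b * \<bar>y i\<bar>)" if "x \<in> C" for x
    unfolding inner_vec_def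
    by (rule order_trans[OF sum_abs sum_mono]) (use b that in \<open>auto simp: abs_mult intro!: mult_right_mono\<close>)
  then show ?thesis using AE_uniform by (intro that[of "\<Sum>i<n. b * \<bar>y i\<bar>"]) (auto elim: eventually_mono)
qed

lemma linear_functional_power_integrable: "integrable uniform (\<lambda>x. inner_vec n x y ^ k)"
proof -
  obtain b where "AE x in uniform. \<bar>inner_vec n x y\<bar> \<le> b"
    using linear_functional_bounded by blast
  then have "AE x in uniform. norm (inner_vec n x y ^ k) \<le> b ^ k"
    by eventually_elim (auto simp: power_abs intro: power_mono)
  then show ?thesis by (rule integrable_const_bound) measurable
qed

lemma coordinate_integrable: "i < n \<Longrightarrow> integrable uniform (\<lambda>x. x i)"
  using linear_functional_power_integrable[of "unit_vec n i" 1] by (simp add: inner_unit_vec)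

lemma linear_functional_mean: "(\<integral>x. inner_vec n x y \<partial>uniform) = 0"
proof -
  have "(\<integral>x. x i \<partial>uniform) = 0" if i: "i < n" for i
  proof -
    have "(\<lambda>x. x i) \<in> borel_measurable (vol n)"
      using borel_measurable_integrable[OF coordinate_integrable[OF i]] by simp
    then show ?thesis
      using fun_cong[OF bary, of i] i by (simp add: barycenter_def zero_vec_def volume integral_uniform)
  qed
  then show ?thesis
    unfolding inner_vec_def by (subst Bochner_Integration.integral_sum) (auto simp: coordinate_integrable)
qed

lemma linear_functional_variance:
  assumes "y \<in> unit_sphere n"
  shows "(\<integral>x. (inner_vec n x y)\<^sup>2 \<partial>uniform) = L\<^sup>2"
  using isoconst assms unfolding has_isotropic_constant_def by (subst integral_uniform[symmetric]) auto

text \<open>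
  The midpoint of a point of \<open>C\<close> at height at least \<open>a\<close> and one at height at least \<open>b\<close> is a point of
  \<open>C\<close> at height at least \<open>(a + b) / 2\<close>, so Prekopa-Leindler applies to the three indicators.
\<close>

lemma tail_log_concave:
  "prob {x\<in>space uniform. a \<le> inner_vec n x y} * prob {x\<in>space uniform. b \<le> inner_vec n x y}
    \<le> (prob {x\<in>space uniform. (a + b) / 2 \<le> inner_vec n x y})\<^sup>2"
proof -
  let ?A = "\<lambda>a. {x \<in> space (vol n). a \<le> inner_vec n x y}"
  have A[measurable]: "?A a \<in> sets (vol n)" for a by measurable
  have "emeasure (vol n) (C \<inter> ?A a) * emeasure (vol n) (C \<inter> ?A b) \<le> (emeasure (vol n) (C \<inter> ?A ((a + b) / 2)))\<^sup>2"
  proof -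
    have nn: "emeasure (vol n) (C \<inter> ?A a) = (\<integral>\<^sup>+x. indicator (C \<inter> ?A a) x \<partial>PiM {..<n} (\<lambda>_. lborel))" for a
      unfolding vol_def[symmetric] by (rule nn_integral_indicator[symmetric]) measurable
    show ?thesis unfolding nn
    proof (rule prekopa_leindler_PiM)
      fix u v :: "nat \<Rightarrow> real"
      let ?m = "\<lambda>i\<in>{..<n}. (u i + v i) / 2"
      have "?m \<in> C \<inter> ?A ((a + b) / 2)" if "u \<in> C \<inter> ?A a" "v \<in> C \<inter> ?A b"
      proof -
        have "convex_set n C" using body by (simp add: convex_body_def)
        then have "add_vec n (scale_vec n (1/2) u) (scale_vec n (1/2) v) \<in> C"
          using that unfolding convex_set_def by auto
        also have "add_vec n (scale_vec n (1/2) u) (scale_vec n (1/2) v) = ?m"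
          by (auto simp: add_vec_def scale_vec_def fun_eq_iff add_divide_distrib)
        finally have "?m \<in> C" .
        moreover have "(a + b) / 2 \<le> inner_vec n ?m y"
          using that by (simp add: inner_vec_midpoint)
        ultimately show ?thesis by (simp add: space_vol)
      qed
      then show "indicator (C \<inter> ?A a) u * indicator (C \<inter> ?A b) v \<le> (indicator (C \<inter> ?A ((a + b) / 2)) ?m :: ennreal)\<^sup>2"
        by (cases "u \<in> C \<inter> ?A a \<and> v \<in> C \<inter> ?A b") (simp_all only: indicator_simps, auto)
    qed (unfold vol_def[symmetric], measurable)
  qed
  then have "emeasure uniform (?A a) * emeasure uniform (?A b) \<le> (emeasure uniform (?A ((a + b) / 2)))\<^sup>2"
    by (simp add: emeasure_uniform)
  then show ?thesis
    by (simp add: emeasure_eq_measure ennreal_mult[symmetric] ennreal_power)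
qed

lemma linear_functional_fourth_moment:
  assumes "y \<in> unit_sphere n"
  shows "(\<integral>x. inner_vec n x y ^ 4 \<partial>uniform) \<le> fourth_moment_const * L ^ 4"
proof (rule fourth_moment_bound)
  fix a b
  have *: "- inner_vec n x y = inner_vec n x (scale_vec n (-1) y)" for x
    by (simp add: inner_scale_right)
  show "prob {x\<in>space uniform. a \<le> - inner_vec n x y} * prob {x\<in>space uniform. b \<le> - inner_vec n x y}
    \<le> (prob {x\<in>space uniform. (a + b) / 2 \<le> - inner_vec n x y})\<^sup>2"
    unfolding * by (rule tail_log_concave)
  show "prob {x\<in>space uniform. a \<le> inner_vec n x y} * prob {x\<in>space uniform. b \<le> inner_vec n x y}
    \<le> (prob {x\<in>space uniform. (a + b) / 2 \<le> inner_vec n x y})\<^sup>2"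
    by (rule tail_log_concave)
qed (use assms L_pos in \<open>simp_all add: linear_functional_variance linear_functional_power_integrable\<close>)

lemma centred_linear_functional:
  assumes "y \<in> unit_sphere n"
  obtains b where "centred_bounded_rv uniform (\<lambda>x. inner_vec n x y) b (L\<^sup>2) (\<integral>x. inner_vec n x y ^ 4 \<partial>uniform)"
proof -
  obtain b where "AE x in uniform. \<bar>inner_vec n x y\<bar> \<le> b"
    using linear_functional_bounded by blast
  then show ?thesis
    using assms by (intro that[of b] centred_bounded_rv.intro centred_bounded_rv_axioms.intro prob_space_axioms)
      (auto simp: linear_functional_mean linear_functional_variance)
qed

abbreviation samples :: "nat \<Rightarrow> (nat \<Rightarrow> nat \<Rightarrow> real) measure"
  where "samples s \<equiv> PiM {..<s} (\<lambda>_. uniform)"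

lemma samples_eq_density: "samples s = density (PiM {..<s} (\<lambda>_. vol n)) (indicator (PiE {..<s} (\<lambda>_. C)))"
  unfolding uniform_def
  by (rule PiM_density_indicator[OF sigma_finite_vol C_measurable]) (simp add: emeasure_C)

lemma sets_samples: "sets (samples s) = sets (PiM {..<s} (\<lambda>_. vol n))"
  by (rule sets_PiM_cong) simp_all

lemma multi_norm_eq:
  assumes "gauge_norm n K \<in> borel_measurable (vol n)"
  shows "multi_norm n s C K t = (\<integral>x. gauge_norm n K (lincomb n s t x) \<partial>samples s)"
proof -
  have m: "PiE {..<s} (\<lambda>_. C) \<in> sets (PiM {..<s} (\<lambda>_. vol n))"
    by (intro sets_PiM_I_finite) (auto simp: C_measurable)
  have "samples s = density (PiM {..<s} (\<lambda>_. vol n)) (\<lambda>x. ennreal (indicator (PiE {..<s} (\<lambda>_. C)) x))"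
    by (simp add: samples_eq_density ennreal_indicator)
  then show ?thesis
    unfolding multi_norm_def set_lebesgue_integral_def
    using measurable_compose[OF lincomb_measurable assms] m
    by (simp add: integral_density)
qed

text \<open>
  The square of the Euclidean norm is the sum over the coordinates, each of which is a weighted sum
  of independent copies of a linear functional with variance \<open>L\<^sup>2\<close>.
\<close>

lemma lincomb_norm_moments:
  defines "Z \<equiv> \<lambda>s t x. L2_set (lincomb n s t x) {..<n}"
  shows "integrable (samples s) (Z s t)"
    and "(\<integral>x. Z s t x \<partial>samples s) \<le> sqrt n * L * L2_set t {..<s}"
proof -
  interpret P: prob_space "samples s" by (intro prob_space_PiM prob_space_axioms)
  let ?W = "\<lambda>i x. \<Sum>j<s. t j * inner_vec n (x j) (unit_vec n i)"
  have W: "integrable (samples s) (\<lambda>x. (?W i x)\<^sup>2)"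
    "(\<integral>x. (?W i x)\<^sup>2 \<partial>samples s) = L\<^sup>2 * (\<Sum>j<s. (t j)\<^sup>2)" if i: "i < n" for i
  proof -
    obtain b where "centred_bounded_rv uniform (\<lambda>x. inner_vec n x (unit_vec n i)) b (L\<^sup>2)
        (\<integral>x. inner_vec n x (unit_vec n i) ^ 4 \<partial>uniform)"
      using centred_linear_functional[OF unit_vec_in_sphere[OF i]] by blast
    then interpret c: centred_bounded_rv uniform "\<lambda>x. inner_vec n x (unit_vec n i)" b "L\<^sup>2"
        "\<integral>x. inner_vec n x (unit_vec n i) ^ 4 \<partial>uniform" .
    show "integrable (samples s) (\<lambda>x. (?W i x)\<^sup>2)"
      "(\<integral>x. (?W i x)\<^sup>2 \<partial>samples s) = L\<^sup>2 * (\<Sum>j<s. (t j)\<^sup>2)"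
      using c.wsum_power_integrable[of s t 2] c.wsum_second_moment[of s t] by (simp_all add: c.wsum_def)
  qed
  have Z2: "(Z s t x)\<^sup>2 = (\<Sum>i<n. (?W i x)\<^sup>2)" for x
  proof -
    have "(Z s t x)\<^sup>2 = (\<Sum>i<n. (lincomb n s t x i)\<^sup>2)"
      by (simp add: Z_def L2_set_def sum_nonneg)
    also have "\<dots> = (\<Sum>i<n. (?W i x)\<^sup>2)"
      unfolding inner_lincomb[symmetric] by (intro sum.cong) (simp_all add: inner_unit_vec)
    finally show ?thesis .
  qed
  have int2: "integrable (samples s) (\<lambda>x. (Z s t x)\<^sup>2)" unfolding Z2 by (intro Bochner_Integration.integrable_sum W(1)) simp
  have meas: "Z s t \<in> borel_measurable (samples s)"
  proof -
    have "Z s t = (\<lambda>x. sqrt ((Z s t x)\<^sup>2))" by (auto simp: Z_def)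
    also have "\<dots> \<in> borel_measurable (samples s)" using borel_measurable_integrable[OF int2] by measurable
    finally show ?thesis .
  qed
  show int1: "integrable (samples s) (Z s t)"
  proof (rule Bochner_Integration.integrable_bound[OF _ meas])
    show "integrable (samples s) (\<lambda>x. 1 + (Z s t x)\<^sup>2)" using int2 by simp
    have "\<bar>z\<bar> \<le> 1 + z\<^sup>2" for z :: real
      using sum_squares_bound[of 1 "\<bar>z\<bar>"] by (simp add: power2_eq_square)
    then show "AE x in samples s. norm (Z s t x) \<le> norm (1 + (Z s t x)\<^sup>2)"
      by (intro AE_I2) (simp add: abs_of_nonneg)
  qed
  have "(\<integral>x. (Z s t x)\<^sup>2 \<partial>samples s) = n * (L\<^sup>2 * (\<Sum>j<s. (t j)\<^sup>2))"
    unfolding Z2 using W by (subst Bochner_Integration.integral_sum) auto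
  then have "sqrt (\<integral>x. (Z s t x)\<^sup>2 \<partial>samples s) = sqrt n * L * L2_set t {..<s}"
    using L_pos by (simp add: real_sqrt_mult L2_set_def)
  then show "(\<integral>x. Z s t x \<partial>samples s) \<le> sqrt n * L * L2_set t {..<s}"
    using P.square_mean_le[OF int1 int2] by simp
qed

lemma functional_first_moment:
  assumes y: "y \<in> unit_sphere n"
  shows "integrable (samples s) (\<lambda>x. \<bar>inner_vec n (lincomb n s t x) y\<bar>)"
    and "L * L2_set t {..<s} / (2 * sqrt (2 * (fourth_moment_const + 3)))
      \<le> (\<integral>x. \<bar>inner_vec n (lincomb n s t x) y\<bar> \<partial>samples s)"
proof -
  interpret P: prob_space "samples s" by (intro prob_space_PiM prob_space_axioms)
  let ?m = "\<integral>x. inner_vec n x y ^ 4 \<partial>uniform"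
  obtain b where "centred_bounded_rv uniform (\<lambda>x. inner_vec n x y) b (L\<^sup>2) ?m"
    using centred_linear_functional[OF y] by blast
  then interpret c: centred_bounded_rv uniform "\<lambda>x. inner_vec n x y" b "L\<^sup>2" ?m .
  have w: "inner_vec n (lincomb n s t x) y = c.wsum s t x" for x
    by (simp add: inner_lincomb c.wsum_def)
  have int1: "integrable (samples s) (c.wsum s t)"
    using c.wsum_power_integrable[of s t 1] by simp
  then show "integrable (samples s) (\<lambda>x. \<bar>inner_vec n (lincomb n s t x) y\<bar>)" by (simp add: w)
  show "L * L2_set t {..<s} / (2 * sqrt (2 * (fourth_moment_const + 3)))
      \<le> (\<integral>x. \<bar>inner_vec n (lincomb n s t x) y\<bar> \<partial>samples s)"
  proof (cases "L2_set t {..<s} = 0")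
    case False
    have nn: "0 \<le> fourth_moment_const"
      unfolding fourth_moment_const_def by (intro suminf_nonneg fourth_moment_const_summable) auto
    have T: "(L2_set t {..<s})\<^sup>2 = (\<Sum>j<s. (t j)\<^sup>2)" by (simp add: L2_set_def sum_nonneg)
    show ?thesis unfolding w
    proof (rule P.first_moment_lower_bound[OF int1])
      show "0 < L * L2_set t {..<s}" using L_pos False by (simp add: less_le)
      show "(\<integral>x. (c.wsum s t x)\<^sup>2 \<partial>samples s) = (L * L2_set t {..<s})\<^sup>2"
        by (simp add: c.wsum_second_moment power_mult_distrib T)
      have "(\<integral>x. c.wsum s t x ^ 4 \<partial>samples s) \<le> (?m + 3 * (L\<^sup>2)\<^sup>2) * ((L2_set t {..<s})\<^sup>2)\<^sup>2"
        unfolding T by (rule c.wsum_fourth_moment)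
      also have "\<dots> \<le> (fourth_moment_const * L ^ 4 + 3 * (L\<^sup>2)\<^sup>2) * ((L2_set t {..<s})\<^sup>2)\<^sup>2"
        using linear_functional_fourth_moment[OF y] by (intro mult_right_mono) auto
      also have "\<dots> = (fourth_moment_const + 3) * (L * L2_set t {..<s}) ^ 4"
        by (simp add: power_mult_distrib algebra_simps flip: power_mult)
      finally show "(\<integral>x. c.wsum s t x ^ 4 \<partial>samples s) \<le> (fourth_moment_const + 3) * (L * L2_set t {..<s}) ^ 4" .
    qed (use nn c.wsum_power_integrable in auto)
  qed simp
qed

text \<open>
  The lower bound holds with the norm of each individual \<open>y\<close> of the polar body in place of the
  radius. Passing to the supremum avoids showing that the radius is attained.
\<close>

theorem multi_norm_bounds:
  assumes "convex_body n K" "centrally_symmetric n K"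
  shows "1 / (2 * sqrt (2 * (fourth_moment_const + 3))) * L * radius n (polar n K) * L2_set t {..<s}
      \<le> multi_norm n s C K t"
    and "multi_norm n s C K t \<le> sqrt (real n) * L * radius n (polar n K) * L2_set t {..<s}"
proof -
  interpret K: symmetric_convex_body n K
    using assms dim by unfold_locales
  let ?g = "\<lambda>x. gauge_norm n K (lincomb n s t x)" and ?Z = "\<lambda>x. L2_set (lincomb n s t x) {..<n}"
  have g: "0 \<le> ?g x" "?g x \<le> K.R * ?Z x" for x
    using K.gauge_nonneg K.gauge_le lincomb_in_space by auto
  have "?g \<in> borel_measurable (PiM {..<s} (\<lambda>_. vol n))"
    using measurable_compose[OF lincomb_measurable K.gauge_measurable] .
  then have meas: "?g \<in> borel_measurable (samples s)"
    by (simp cong: measurable_cong_sets add: sets_samples)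
  have intZ: "integrable (samples s) (\<lambda>x. K.R * ?Z x)"
    using lincomb_norm_moments(1)[of s t] by simp
  have intg: "integrable (samples s) ?g"
    by (rule Bochner_Integration.integrable_bound[OF intZ meas]) (use g K.R_pos in \<open>auto simp: abs_mult\<close>)
  note eq = multi_norm_eq[OF K.gauge_measurable, of s t]
  have "multi_norm n s C K t \<le> (\<integral>x. K.R * ?Z x \<partial>samples s)"
    unfolding eq using intg intZ g by (intro integral_mono) auto
  also have "\<dots> = K.R * (\<integral>x. ?Z x \<partial>samples s)" by simp
  also have "\<dots> \<le> K.R * (sqrt n * L * L2_set t {..<s})"
    using K.R_pos lincomb_norm_moments(2)[of s t] by (intro mult_left_mono) auto
  finally show "multi_norm n s C K t \<le> sqrt (real n) * L * radius n (polar n K) * L2_set t {..<s}"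
    by (simp add: K.radius_polar ac_simps)
  define a where "a = L * L2_set t {..<s} / (2 * sqrt (2 * (fourth_moment_const + 3)))"
  have nonneg: "0 \<le> multi_norm n s C K t"
    unfolding eq using g by (intro integral_nonneg_AE) auto
  have lower: "L2_set y {..<n} * a \<le> multi_norm n s C K t" if y: "y \<in> polar n K" for y
  proof (cases "L2_set y {..<n} = 0")
    case False
    define r where "r = L2_set y {..<n}"
    have r: "0 < r" using False by (simp add: r_def less_le)
    define th where "th = scale_vec n (1 / r) y"
    have th: "th \<in> unit_sphere n"
      using r by (simp add: unit_sphere_def topspace_Rn th_def scale_in_space L2_scale) (simp add: r_def)
    have "r * a \<le> r * (\<integral>x. \<bar>inner_vec n (lincomb n s t x) th\<bar> \<partial>samples s)"
      unfolding a_def using functional_first_moment(2)[OF th] r by (intro mult_left_mono) auto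
    also have "\<dots> = (\<integral>x. r * \<bar>inner_vec n (lincomb n s t x) th\<bar> \<partial>samples s)" by simp
    also have "\<dots> \<le> multi_norm n s C K t"
      unfolding eq
    proof (rule integral_mono[OF _ intg])
      show "integrable (samples s) (\<lambda>x. r * \<bar>inner_vec n (lincomb n s t x) th\<bar>)"
        using functional_first_moment(1)[OF th] by simp
      show "r * \<bar>inner_vec n (lincomb n s t x) th\<bar> \<le> ?g x" for x
        using K.gauge_ge[OF lincomb_in_space y] r by (simp add: th_def inner_scale_right abs_mult)
    qed
    finally show ?thesis by (simp add: r_def)
  qed (use nonneg in simp)
  have "K.R * a \<le> multi_norm n s C K t"
  proof (cases "a \<le> 0")
    case True
    then have "K.R * a \<le> 0" using K.R_pos by (simp add: mult_nonneg_nonpos)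
    then show ?thesis using nonneg by linarith
  next
    case False
    then have "K.R \<le> multi_norm n s C K t / a"
      using lower by (intro K.R_least) (simp add: field_simps)
    then show ?thesis using False by (simp add: field_simps)
  qed
  then show "1 / (2 * sqrt (2 * (fourth_moment_const + 3))) * L * radius n (polar n K) * L2_set t {..<s}
      \<le> multi_norm n s C K t"
    by (simp add: a_def K.radius_polar ac_simps)
qed

end


theorem theorem1p3:
  "\<exists>c1::real. c1 > 0 \<and>
    (\<forall>(n::nat) (C :: (nat \<Rightarrow> real) set) (K :: (nat \<Rightarrow> real) set).
      n \<ge> 1 \<longrightarrow> isotropic n C \<longrightarrow> convex_body n K \<longrightarrow> centrally_symmetric n K \<longrightarrow>
      (\<forall>(s::nat) (t :: nat \<Rightarrow> real). s \<ge> 1 \<longrightarrow>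
        c1 * isotropic_constant n C * radius n (polar n K) * L2_set t {..<s}
          \<le> multi_norm n s C K t \<and>
        multi_norm n s C K t
          \<le> sqrt (real n) * isotropic_constant n C * radius n (polar n K) * L2_set t {..<s}))"
proof (intro exI[of _ "1 / (2 * sqrt (2 * (fourth_moment_const + 3)))"] conjI allI impI)
  have "0 \<le> fourth_moment_const"
    unfolding fourth_moment_const_def by (intro suminf_nonneg fourth_moment_const_summable) auto
  then show "0 < 1 / (2 * sqrt (2 * (fourth_moment_const + 3)))" by simp
  fix n s :: nat and C K :: "(nat \<Rightarrow> real) set" and t :: "nat \<Rightarrow> real"
  assume n: "1 \<le> n" and C: "isotropic n C" and K: "convex_body n K" "centrally_symmetric n K"
  from C obtain L where "has_isotropic_constant n C L" by (auto simp: isotropic_def)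
  with C n interpret isotropic_body n C L
    by unfold_locales (auto simp: isotropic_def)
  show "1 / (2 * sqrt (2 * (fourth_moment_const + 3))) * isotropic_constant n C * radius n (polar n K) * L2_set t {..<s}
      \<le> multi_norm n s C K t"
    "multi_norm n s C K t \<le> sqrt (real n) * isotropic_constant n C * radius n (polar n K) * L2_set t {..<s}"
    unfolding isotropic_constant_eq by (rule multi_norm_bounds[OF K])+
qed

end
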